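(* Let $C\subset\mathbb{P}^2$ be a rational plane algebraic curve over $\mathbb{C}$ of degree $d\geq 3$ given by a parametrization $\varphi(s,t)=(\varphi_0(s,t):\varphi_1(s,t):\varphi_2(s,t))$, $(s:t)\in\mathbb{P}^1$. Put $(q_0,q_1,q_2,q_3,q_4,q_5)=(\varphi_0^2,\varphi_1^2,\varphi_2^2,\varphi_1\varphi_2,\varphi_0\varphi_2,\varphi_0\varphi_1)$ and let $\omega(s,t)$ be the determinant of the $6\times6$ matrix whose first row is $$(x^2,\;y^2,\;z^2,\;yz,\;xz,\;xy)$$ and whose remaining five rows are, for $i=0,1,2,3,4$ in this order, $$\left(\frac{\partial^4 q_0}{\partial s^{4-i}\partial t^{i}},\;\frac{\partial^4 q_1}{\partial s^{4-i}\partial t^{i}},\;\dots,\;\frac{\partial^4 q_5}{\partial s^{4-i}\partial t^{i}}\right).$$ Then, for a smooth point $p=\varphi(s_0,t_0)$ of $C$, the polynomial $\omega(s_0,t_0)\in\mathbb{C}[x,y,z]_2$ is the defining polynomial of the osculating curve of degree $2$ to $C$ at $p$.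
   Context: A rational plane curve is an irreducible plane curve of geometric genus $0$; the parametrization $\varphi$ is birational onto $C$ and given by homogeneous polynomials $\varphi_0,\varphi_1,\varphi_2\in\mathbb{C}[s,t]$ of degree $d$ without common factor. For a smooth point $p$ on $C$, the osculating curve of degree $2$ to $C$ at $p$ is the curve $O_p$ of degree $2$ (not necessarily irreducible or reduced) with intersection multiplicity $(O_p\cdot C)_p\ge5$. If $p$ is an inflection point (i.e. the tangent line meets $C$ at $p$ with multiplicity $>2$), this osculating curve is the double tangent line; if $p$ is not an inflection point it is called the osculating conic at $p$.
   Formalization: Added hypothesis: the tangent line at p meets C at p with multiplicity at most 3. At smooth points with tangent multiplicity 4 or more, ω(s_0,t_0) is the zero polynomial, e.g. φ=(s^4:s^3t:t^4) at (1:0), so the printed claim fails exactly there. *)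

theory Defs
  imports
    "Jordan_Normal_Form.Determinant"
    "HOL-Computational_Algebra.Computational_Algebra"
    "HOL-Library.Extended_Nat"
begin

text \<open>
  Points and tuples of polynomials are functions on \<open>nat\<close>, of which only the indices
  \<open>0, 1\<close> (for the coordinates of the line) or \<open>0, 1, 2\<close> (for the plane) matter.
  In \<open>bipoly\<close> the outermost variable is \<open>s\<close> and the innermost one is \<open>t\<close>;
  in \<open>tripoly\<close> the variables are, from the outside in, \<open>x\<close>, \<open>y\<close>, \<open>z\<close>.
\<close>

type_synonym bipoly = "complex poly poly"
type_synonym tripoly = "complex poly poly poly"

abbreviation const2 :: "complex \<Rightarrow> bipoly" where
  "const2 c \<equiv> [:[:c:]:]"

abbreviation const3 :: "complex \<Rightarrow> tripoly" where
  "const3 c \<equiv> [:[:[:c:]:]:]"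

definition vars2 :: "nat \<Rightarrow> bipoly" where
  "vars2 i = [ [:0, 1:], [:[:0, 1:]:] ] ! i"

definition vars3 :: "nat \<Rightarrow> tripoly" where
  "vars3 i = [ [:0, 1:], [:[:0, 1:]:], [:[:[:0, 1:]:]:] ] ! i"

text \<open>
  Evaluation along a homomorphism \<open>h\<close> on the constants: \<open>h = id\<close> gives the value at a point,
  \<open>h = const2\<close> or \<open>h = const3\<close> gives substitution of polynomials for the variables.
\<close>

definition peval :: "('a::zero \<Rightarrow> 'b::comm_ring_1) \<Rightarrow> 'a poly \<Rightarrow> 'b \<Rightarrow> 'b" where
  "peval h P x = poly (map_poly h P) x"

definition eval2 :: "(complex \<Rightarrow> 'b::comm_ring_1) \<Rightarrow> bipoly \<Rightarrow> (nat \<Rightarrow> 'b) \<Rightarrow> 'b" where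
  "eval2 h P u = peval (\<lambda>Q. peval h Q (u 1)) P (u 0)"

definition eval3 :: "(complex \<Rightarrow> 'b::comm_ring_1) \<Rightarrow> tripoly \<Rightarrow> (nat \<Rightarrow> 'b) \<Rightarrow> 'b" where
  "eval3 h P u = peval (\<lambda>Q. peval (\<lambda>R. peval h R (u 2)) Q (u 1)) P (u 0)"

text \<open>Homogeneous polynomials of a given degree; the zero polynomial is one of every degree.\<close>

definition form2 :: "nat \<Rightarrow> bipoly \<Rightarrow> bool" where
  "form2 n P \<longleftrightarrow> (\<forall>i j. coeff (coeff P i) j \<noteq> 0 \<longrightarrow> i + j = n)"

definition form3 :: "nat \<Rightarrow> tripoly \<Rightarrow> bool" where
  "form3 n P \<longleftrightarrow> (\<forall>i j k. coeff (coeff (coeff P i) j) k \<noteq> 0 \<longrightarrow> i + j + k = n)"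

definition pd_s :: "bipoly \<Rightarrow> bipoly" where
  "pd_s = pderiv"

definition pd_t :: "bipoly \<Rightarrow> bipoly" where
  "pd_t = map_poly pderiv"

definition pd3 :: "nat \<Rightarrow> tripoly \<Rightarrow> tripoly" where
  "pd3 i = [ pderiv, map_poly pderiv, map_poly (map_poly pderiv) ] ! i"

text \<open>
  The map from the projective line to the curve \<open>F = 0\<close> (\<open>F\<close> an irreducible form) given by
  the forms \<open>\<phi> 0, \<phi> 1, \<phi> 2\<close> has a rational inverse \<open>\<psi> = (\<psi> 0 : \<psi> 1)\<close>.  Divisibility by \<open>F\<close>
  expresses vanishing on the curve, and two rational maps into a projective space agree if
  the 2 by 2 minors of their coordinates vanish.
\<close>

definition birational_onto :: "(nat \<Rightarrow> bipoly) \<Rightarrow> tripoly \<Rightarrow> bool" where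
  "birational_onto \<phi> F \<longleftrightarrow>
     eval3 const2 F \<phi> = 0 \<and>
     (\<exists>\<psi> e.
        (\<forall>i<2. form3 e (\<psi> i)) \<and> (\<exists>i<2. \<not> F dvd \<psi> i) \<and>
        (\<exists>i<2. eval3 const2 (\<psi> i) \<phi> \<noteq> 0) \<and>
        eval3 const2 (\<psi> 0) \<phi> * vars2 1 = eval3 const2 (\<psi> 1) \<phi> * vars2 0 \<and>
        (\<exists>i<3. \<not> F dvd eval2 const3 (\<phi> i) \<psi>) \<and>
        (\<forall>i<3. \<forall>j<3. F dvd eval2 const3 (\<phi> i) \<psi> * vars3 j - eval2 const3 (\<phi> j) \<psi> * vars3 i))"

definition rational_parametrization :: "nat \<Rightarrow> (nat \<Rightarrow> bipoly) \<Rightarrow> tripoly \<Rightarrow> bool" where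
  "rational_parametrization d \<phi> F \<longleftrightarrow>
     (\<forall>i<3. form2 d (\<phi> i)) \<and>
     (\<forall>h. (\<forall>i<3. h dvd \<phi> i) \<longrightarrow> is_unit h) \<and>
     birational_onto \<phi> F"

definition smooth_point :: "tripoly \<Rightarrow> (nat \<Rightarrow> complex) \<Rightarrow> bool" where
  "smooth_point F p \<longleftrightarrow> eval3 id F p = 0 \<and> (\<exists>i<3. eval3 id (pd3 i F) p \<noteq> 0)"

definition tangent_line :: "tripoly \<Rightarrow> (nat \<Rightarrow> complex) \<Rightarrow> tripoly" where
  "tangent_line F p = (\<Sum>i<3. const3 (eval3 id (pd3 i F) p) * vars3 i)"

text \<open>
  The local ring of the projective plane at \<open>p\<close>, inside the fraction field of the homogeneous
  coordinate ring, and the ideal generated in it by the local equations of \<open>F\<close> and \<open>G\<close>.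
\<close>

definition local_ring :: "(nat \<Rightarrow> complex) \<Rightarrow> tripoly fract set" where
  "local_ring p = {Fract A H | A H n. form3 n A \<and> form3 n H \<and> eval3 id H p \<noteq> 0}"

definition local_ideal :: "(nat \<Rightarrow> complex) \<Rightarrow> tripoly \<Rightarrow> tripoly \<Rightarrow> tripoly fract set" where
  "local_ideal p F G = {Fract (A * F + B * G) H | A B H n.
     form3 n (A * F) \<and> form3 n (B * G) \<and> form3 n H \<and> eval3 id H p \<noteq> 0}"

text \<open>
  The intersection multiplicity is the complex dimension of the quotient of the local ring
  by this ideal, that is, the supremum of the sizes of finite subsets of the local ring that are
  linearly independent modulo the ideal.
\<close>

definition intersection_mult :: "(nat \<Rightarrow> complex) \<Rightarrow> tripoly \<Rightarrow> tripoly \<Rightarrow> enat" where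
  "intersection_mult p F G =
     (SUP B \<in> {B. finite B \<and> B \<subseteq> local_ring p \<and>
                  (\<forall>c. (\<Sum>b\<in>B. Fract (const3 (c b)) 1 * b) \<in> local_ideal p F G
                       \<longrightarrow> (\<forall>b\<in>B. c b = 0))}. enat (card B))"

definition inflection_point :: "tripoly \<Rightarrow> (nat \<Rightarrow> complex) \<Rightarrow> bool" where
  "inflection_point F p \<longleftrightarrow>
     smooth_point F p \<and> intersection_mult p (tangent_line F p) F > 2"

definition same_curve :: "tripoly \<Rightarrow> tripoly \<Rightarrow> bool" where
  "same_curve Q R \<longleftrightarrow> (\<exists>c. c \<noteq> 0 \<and> Q = const3 c * R)"

text \<open>Degree 2 curves need be neither irreducible nor reduced.\<close>

definition meets_to_order5 :: "tripoly \<Rightarrow> (nat \<Rightarrow> complex) \<Rightarrow> tripoly \<Rightarrow> bool" where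
  "meets_to_order5 F p Q \<longleftrightarrow> form3 2 Q \<and> Q \<noteq> 0 \<and> intersection_mult p Q F \<ge> 5"

text \<open>
  At a point where the tangent line meets the curve with multiplicity at least 4, its products with
  all lines through the point have multiplicity at least 5 too; the clause on inflection points
  singles out the double tangent line among them.
\<close>

definition osculating_curve2 :: "tripoly \<Rightarrow> (nat \<Rightarrow> complex) \<Rightarrow> tripoly \<Rightarrow> bool" where
  "osculating_curve2 F p Q \<longleftrightarrow>
     meets_to_order5 F p Q \<and>
     (inflection_point F p \<longrightarrow> same_curve Q ((tangent_line F p)\<^sup>2))"

text \<open>The monomials of degree 2 in \<open>v 0, v 1, v 2\<close>, squares first.\<close>

definition quad :: "(nat \<Rightarrow> 'a::comm_ring_1) \<Rightarrow> nat \<Rightarrow> 'a" where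
  "quad v j = [(v 0)\<^sup>2, (v 1)\<^sup>2, (v 2)\<^sup>2, v 1 * v 2, v 0 * v 2, v 0 * v 1] ! j"

text \<open>Row \<open>i + 1\<close> carries the derivatives of order \<open>4 - i\<close> in \<open>s\<close> and \<open>i\<close> in \<open>t\<close>.\<close>

definition omega :: "(nat \<Rightarrow> bipoly) \<Rightarrow> (nat \<Rightarrow> complex) \<Rightarrow> tripoly" where
  "omega \<phi> u = det (mat 6 6 (\<lambda>(r, j).
     case r of
       0 \<Rightarrow> quad vars3 j
     | Suc i \<Rightarrow> const3 (eval2 id ((pd_s ^^ (4 - i)) ((pd_t ^^ i) (quad \<phi> j))) u)))"

end

(*
  Restrict phi to a line u + X v through u. The pullback A -> A(phi(u + X v)) maps the local ring of
  the plane at p to complex[[X]] and kills F, since the parametrization lies on the curve. As p is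
  smooth, every element of the local ring vanishing at p is, modulo F, a multiple of one linear form
  x through p transversal to the curve. Hence all orders of pullbacks are multiples of the order of
  x; the rational inverse of phi provides two pullbacks with consecutive orders, so x has order 1.
  The powers of x then show that the intersection multiplicity of any curve G with F at p is the
  order of G(phi(u + X v)).

  By Euler's formula a form in (s, t) of degree at least 4 vanishes to order 5 at u if its five
  partial derivatives of order 4 vanish there. So the coefficient vector of a conic orthogonal to
  rows 1 to 5 of the matrix gives a conic of contact order 5, in particular that of omega, which
  consists of the cofactors of row 0. In the coordinates l0, x, T (T the tangent line) of orders
  0, 1 and 2 or 3, the conics of contact order at least 5 are seen to form at most a line; this gives
  uniqueness, and together with linear algebra that the cofactors do not all vanish. At a flex T^2
  is such a conic.
*)
theory Submission
  imports Defs "Jordan_Normal_Form.Char_Poly"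
begin

subsection \<open>Evaluation as a ring homomorphism\<close>

lemma comm_ring_hom_peval:
  assumes "comm_ring_hom h"
  shows "comm_ring_hom (\<lambda>P. peval h P x)"
proof -
  interpret h: comm_ring_hom h by fact
  interpret m: map_poly_comm_ring_hom h ..
  show ?thesis
    by unfold_locales (simp_all add: peval_def m.hom_add m.hom_mult)
qed

lemma peval_const: "peval h [:a:] x = h a" if "h 0 = 0"
  using that by (simp add: peval_def Polynomial.map_poly_pCons)

lemma comm_ring_hom_eval2: "comm_ring_hom h \<Longrightarrow> comm_ring_hom (\<lambda>P. eval2 h P u)"
  unfolding eval2_def by (intro comm_ring_hom_peval)

lemma comm_ring_hom_eval3: "comm_ring_hom h \<Longrightarrow> comm_ring_hom (\<lambda>P. eval3 h P u)"
  unfolding eval3_def by (intro comm_ring_hom_peval)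

lemma eval2_const: "eval2 h (const2 c) u = h c" if "comm_ring_hom h"
proof -
  interpret h: comm_ring_hom h by fact
  show ?thesis by (simp add: eval2_def peval_def Polynomial.map_poly_pCons)
qed

lemma eval3_const: "eval3 h (const3 c) u = h c" if "comm_ring_hom h"
proof -
  interpret h: comm_ring_hom h by fact
  show ?thesis by (simp add: eval3_def peval_def Polynomial.map_poly_pCons)
qed

lemma less_2_cases_nat: "i < (2::nat) \<Longrightarrow> i = 0 \<or> i = 1"
  by auto

lemma less_3_cases_nat: "i < (3::nat) \<Longrightarrow> i = 0 \<or> i = 1 \<or> i = 2"
  by auto

lemma eval2_vars: "eval2 h (vars2 i) u = u i" if "comm_ring_hom h" "i < 2"
proof -
  interpret h: comm_ring_hom h by fact
  from less_2_cases_nat[OF that(2)] show ?thesis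
    by (auto simp: eval2_def peval_const peval_def vars2_def)
qed

lemma eval3_vars: "eval3 h (vars3 i) u = u i" if "comm_ring_hom h" "i < 3"
proof -
  interpret h: comm_ring_hom h by fact
  from less_3_cases_nat[OF that(2)] show ?thesis
    by (auto simp: eval3_def peval_const peval_def vars3_def)
qed

text \<open>Constants and the variable generate the polynomial ring. Lifted to two and three
  variables below, this replaces coefficient computations in nested polynomials.\<close>

lemma poly_hom_eqI:
  fixes f g :: "'a::comm_ring_1 poly \<Rightarrow> 'b::comm_ring_1"
  assumes "comm_ring_hom f" "comm_ring_hom g"
    and const: "\<And>c. f [:c:] = g [:c:]" and X: "f [:0, 1:] = g [:0, 1:]"
  shows "f P = g P"
proof -
  interpret f: comm_ring_hom f by fact
  interpret g: comm_ring_hom g by fact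
  show ?thesis
  proof (induction P)
    case (pCons a P)
    have "pCons a P = [:a:] + [:0, 1:] * P" by simp
    then show ?case
      using pCons.IH const X by (metis f.hom_add f.hom_mult g.hom_add g.hom_mult)
  qed simp
qed

lemma comm_ring_hom_const_poly: "comm_ring_hom (\<lambda>c::'a::comm_ring_1. [:c:])"
  by unfold_locales (simp_all add: one_pCons)

lemma comm_ring_hom_compose:
  assumes "comm_ring_hom f" "comm_ring_hom g"
  shows "comm_ring_hom (\<lambda>x. f (g x))"
proof -
  interpret f: comm_ring_hom f by fact
  interpret g: comm_ring_hom g by fact
  show ?thesis
    by unfold_locales (simp_all add: f.hom_add f.hom_mult g.hom_add g.hom_mult)
qed

lemma comm_ring_hom_const2: "comm_ring_hom const2"
  by (intro comm_ring_hom_compose[of "\<lambda>c. [:c:]" "\<lambda>c. [:c:]"] comm_ring_hom_const_poly)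

lemma comm_ring_hom_const3: "comm_ring_hom const3"
  by (intro comm_ring_hom_compose[of "\<lambda>c. [:c:]" const2] comm_ring_hom_const2 comm_ring_hom_const_poly)

lemma comm_ring_hom_id: "comm_ring_hom id"
  by unfold_locales simp_all

lemma comm_ring_hom_fps_const: "comm_ring_hom (fps_const :: 'a::comm_ring_1 \<Rightarrow> _)"
  by unfold_locales simp_all

lemma comm_ring_hom_fps_nth_0: "comm_ring_hom (\<lambda>g::'a::comm_ring_1 fps. g $ 0)"
  by unfold_locales simp_all

lemma bipoly_hom_eqI:
  fixes f g :: "bipoly \<Rightarrow> 'b::comm_ring_1"
  assumes hom: "comm_ring_hom f" "comm_ring_hom g"
    and const: "\<And>c. f (const2 c) = g (const2 c)" and vars: "\<And>i. i < 2 \<Longrightarrow> f (vars2 i) = g (vars2 i)"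
  shows "f P = g P"
proof (rule poly_hom_eqI[OF hom])
  show "f [:0, 1:] = g [:0, 1:]"
    using vars[of 0] by (simp add: vars2_def)
  fix c :: "complex poly"
  note c = comm_ring_hom_compose[OF _ comm_ring_hom_const_poly]
  show "f [:c:] = g [:c:]"
    by (rule poly_hom_eqI[OF c[OF hom(1)] c[OF hom(2)]]) (use const vars[of 1] in \<open>simp_all add: vars2_def\<close>)
qed

lemma tripoly_hom_eqI:
  fixes f g :: "tripoly \<Rightarrow> 'b::comm_ring_1"
  assumes hom: "comm_ring_hom f" "comm_ring_hom g"
    and const: "\<And>c. f (const3 c) = g (const3 c)" and vars: "\<And>i. i < 3 \<Longrightarrow> f (vars3 i) = g (vars3 i)"
  shows "f P = g P"
proof (rule poly_hom_eqI[OF hom])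
  show "f [:0, 1:] = g [:0, 1:]"
    using vars[of 0] by (simp add: vars3_def)
  fix c :: "complex poly poly"
  note c = comm_ring_hom_compose[OF _ comm_ring_hom_const_poly]
  show "f [:c:] = g [:c:]"
    by (rule bipoly_hom_eqI[OF c[OF hom(1)] c[OF hom(2)]])
      (use const vars[of 1] vars[of 2] in \<open>auto simp: vars2_def vars3_def dest!: less_2_cases_nat\<close>)
qed

text \<open>Both sides are ring homomorphisms in \<open>A\<close>, so constants and variables
  suffice. With it, a substitution can be followed by restriction to a line or by taking constant
  terms.\<close>

lemma eval3_hom_compose:
  assumes "comm_ring_hom k" "comm_ring_hom h"
  shows "k (eval3 h A w) = eval3 (\<lambda>c. k (h c)) A (\<lambda>i. k (w i))"
  by (rule tripoly_hom_eqI)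
    (auto intro!: comm_ring_hom_compose[OF assms(1)] comm_ring_hom_eval3 comm_ring_hom_compose assms
      simp: eval3_const eval3_vars assms comm_ring_hom_compose)

lemma eval2_hom_compose:
  assumes "comm_ring_hom k" "comm_ring_hom h"
  shows "k (eval2 h A w) = eval2 (\<lambda>c. k (h c)) A (\<lambda>i. k (w i))"
  by (rule bipoly_hom_eqI)
    (auto intro!: comm_ring_hom_compose[OF assms(1)] comm_ring_hom_eval2 comm_ring_hom_compose assms
      simp: eval2_const eval2_vars assms comm_ring_hom_compose)

lemma eval3_cong: "(\<And>i. i < 3 \<Longrightarrow> v i = w i) \<Longrightarrow> eval3 h A v = eval3 h A w"
  unfolding eval3_def by simp

subsection \<open>Forms\<close>

lemma form3_0 [simp]: "form3 n 0"
  by (simp add: form3_def)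

lemma form3_add: "form3 n A \<Longrightarrow> form3 n B \<Longrightarrow> form3 n (A + B)"
  unfolding form3_def by (metis add.right_neutral coeff_add)

lemma form3_uminus: "form3 n A \<Longrightarrow> form3 n (- A)"
  by (simp add: form3_def)

lemma form3_diff: "form3 n A \<Longrightarrow> form3 n B \<Longrightarrow> form3 n (A - B)"
  using form3_add[of n A "- B"] form3_uminus[of n B] by simp

lemma form3_sum: "(\<And>i. i \<in> I \<Longrightarrow> form3 n (A i)) \<Longrightarrow> form3 n (\<Sum>i\<in>I. A i)"
  by (induction I rule: infinite_finite_induct) (auto intro: form3_add)

lemma form3_const_mult: "form3 n A \<Longrightarrow> form3 n (const3 c * A)"
  by (auto simp: form3_def)

lemma form3_vars_mult:
  assumes "form3 n A" "i < 3"
  shows "form3 (Suc n) (vars3 i * A)"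
proof -
  have X: "coeff ([:0, 1:] * P) k = (case k of 0 \<Rightarrow> 0 | Suc k \<Rightarrow> coeff P k)" for P :: "'a::comm_ring_1 poly" and k
    by (simp add: coeff_pCons)
  have C: "coeff ([:c:] * P) k = c * coeff P k" for c and P :: "'a::comm_ring_1 poly" and k
    by simp
  from less_3_cases_nat[OF assms(2)] show ?thesis
    using assms(1)
    by (auto simp: form3_def vars3_def X C simp del: mult_pCons_left split: nat.splits)
qed

lemma form3_const: "form3 0 (const3 c)"
  by (auto simp: form3_def coeff_pCons split: nat.splits)

lemma form3_vars: "i < 3 \<Longrightarrow> form3 1 (vars3 i)"
  using form3_vars_mult[OF form3_const[of 1]] by (simp flip: one_pCons)

lemma form3_0E:
  assumes "form3 0 A"
  obtains c where "A = const3 c"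
proof
  show "A = const3 (coeff (coeff (coeff A 0) 0) 0)"
    using assms by (auto simp: poly_eq_iff form3_def coeff_pCons split: nat.splits)
qed

text \<open>The monomials are distributed greedily: those containing x go to \<open>B 0\<close>, of
  the rest those containing y to \<open>B 1\<close>, and what remains is divisible by z because the
  degree is positive. This yields the induction on the degree used for all facts about
  forms.\<close>

lemma form3_SucE:
  assumes "form3 (Suc n) A"
  obtains B where "\<And>i. i < 3 \<Longrightarrow> form3 n (B i)" "A = (\<Sum>i<3. vars3 i * B i)"
proof -
  obtain a A0 where A: "A = pCons a A0" by (cases A)
  obtain b a0 where a: "a = pCons b a0" by (cases a)
  obtain c b0 where b: "b = pCons c b0" by (cases b)
  have *: "coeff (coeff (coeff A i) j) k \<noteq> 0 \<Longrightarrow> i + j + k = Suc n" for i j k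
    using assms by (simp add: form3_def)
  define B where "B i = [A0, [:a0:], [:[:b0:]:]] ! i" for i
  show ?thesis
  proof
    show "form3 n (B i)" if "i < 3" for i
      using less_3_cases_nat[OF that]
    proof (elim disjE)
      assume "i = 0" then show ?thesis
        using *[of "Suc _"] by (auto simp: form3_def B_def A)
    next
      assume "i = 1" then show ?thesis
        using *[of 0 "Suc _"] by (auto simp: form3_def B_def A a coeff_pCons split: nat.splits)
    next
      assume "i = 2" then show ?thesis
        using *[of 0 0 "Suc _"] by (auto simp: form3_def B_def A a b coeff_pCons split: nat.splits)
    qed
    have "c = 0"
      using *[of 0 0 0] by (auto simp: A a b)
    then show "A = (\<Sum>i<3. vars3 i * B i)"
      by (simp add: eval_nat_numeral lessThan_Suc B_def vars3_def A a b)
  qed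
qed

lemma form3_induct [consumes 1, case_names const step]:
  assumes "form3 n A"
    and "\<And>c. P 0 (const3 c)"
    and "\<And>n B. (\<And>i. i < 3 \<Longrightarrow> form3 n (B i)) \<Longrightarrow> (\<And>i. i < 3 \<Longrightarrow> P n (B i)) \<Longrightarrow>
           P (Suc n) (\<Sum>i<3. vars3 i * B i)"
  shows "P n A"
  using assms(1)
proof (induction n arbitrary: A)
  case 0
  then show ?case using assms(2) by (metis form3_0E)
next
  case (Suc n)
  then show ?case using assms(3) by (metis form3_SucE)
qed

lemma form3_mult:
  assumes "form3 m A" "form3 n B"
  shows "form3 (m + n) (A * B)"
  using assms(1)
proof (induction rule: form3_induct)
  case (const c)
  show ?case using form3_const_mult[OF assms(2)] by simp
next
  case (step m C)
  show ?case
    unfolding sum_distrib_right mult.assoc add_Suc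
    by (intro form3_sum form3_vars_mult step) auto
qed

lemma form3_power: "form3 m A \<Longrightarrow> form3 (k * m) (A ^ k)"
proof (induction k)
  case 0
  then show ?case using form3_const[of 1] by (simp flip: one_pCons)
next
  case (Suc k)
  then show ?case by (simp add: form3_mult)
qed

lemma eval3_form_const:
  "form3 0 A \<Longrightarrow> A = const3 (eval3 id A p)"
  by (metis comm_ring_hom_id eval3_const form3_0E id_apply)

subsection \<open>Derivations\<close>

text \<open>Additivity and the Leibniz rule pass from the coefficients to polynomials under
  \<open>map_poly\<close>, so one notion covers all partial derivatives of nested
  polynomials.\<close>

definition derivation :: "('a::comm_ring_1 \<Rightarrow> 'a) \<Rightarrow> bool" where
  "derivation D \<longleftrightarrow> (\<forall>a b. D (a + b) = D a + D b) \<and> (\<forall>a b. D (a * b) = D a * b + a * D b)"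

lemma derivation_add: "derivation D \<Longrightarrow> D (a + b) = D a + D b"
  by (simp add: derivation_def)

lemma derivation_mult: "derivation D \<Longrightarrow> D (a * b) = D a * b + a * D b"
  by (simp add: derivation_def)

lemma derivation_0: "derivation D \<Longrightarrow> D 0 = 0"
  using derivation_add[of D 0 0] by simp

lemma derivation_sum: "derivation D \<Longrightarrow> D (\<Sum>i\<in>I. f i) = (\<Sum>i\<in>I. D (f i))"
  by (induction I rule: infinite_finite_induct) (simp_all add: derivation_0 derivation_add)

lemma derivation_pderiv: "derivation (pderiv :: 'a::idom poly \<Rightarrow> _)"
  by (simp add: derivation_def pderiv_add pderiv_mult)

lemma derivation_map_poly:
  assumes "derivation D"
  shows "derivation (map_poly D)"
proof -
  note D = derivation_0[OF assms] derivation_add[OF assms] derivation_mult[OF assms]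
  have add: "map_poly D (P + Q) = map_poly D P + map_poly D Q" for P Q
    by (rule poly_eqI) (simp add: coeff_map_poly D)
  have smult: "map_poly D (smult a B) = smult (D a) B + smult a (map_poly D B)" for a B
    by (rule poly_eqI) (simp add: coeff_map_poly D)
  have "map_poly D (A * B) = map_poly D A * B + A * map_poly D B" for A B
    by (induction A)
      (simp_all add: D Polynomial.map_poly_pCons mult_pCons_left add smult algebra_simps smult_add_right)
  with add show ?thesis by (simp add: derivation_def)
qed

lemma derivation_pd3: "i < 3 \<Longrightarrow> derivation (pd3 i)"
  by (auto simp: pd3_def derivation_pderiv derivation_map_poly dest!: less_3_cases_nat)

lemma derivation_pd_s: "derivation pd_s"
  by (simp add: pd_s_def derivation_pderiv)

lemma derivation_pd_t: "derivation pd_t"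
  by (simp add: pd_t_def derivation_pderiv derivation_map_poly)

lemma pd3_const: "i < 3 \<Longrightarrow> pd3 i (const3 c) = 0"
  by (auto simp: pd3_def Polynomial.map_poly_pCons pderiv_pCons dest!: less_3_cases_nat)

lemma pd3_vars: "i < 3 \<Longrightarrow> j < 3 \<Longrightarrow> pd3 j (vars3 i) = (if i = j then 1 else 0)"
  by (elim less_3_cases_nat[THEN disjE] disjE)
    (simp_all add: pd3_def vars3_def Polynomial.map_poly_pCons pderiv_pCons map_poly_1 flip: one_pCons)

lemma pd3_lincomb:
  "j < 3 \<Longrightarrow> pd3 j (\<Sum>i<3. vars3 i * B i) = B j + (\<Sum>i<3. vars3 i * pd3 j (B i))"
proof -
  assume j: "j < 3"
  have "pd3 j (\<Sum>i<3. vars3 i * B i) = (\<Sum>i<3. (if i = j then B i else 0) + vars3 i * pd3 j (B i))"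
    using j unfolding derivation_sum[OF derivation_pd3[OF j]] derivation_mult[OF derivation_pd3[OF j]]
    by (intro sum.cong refl) (simp add: pd3_vars)
  with j show ?thesis by (simp add: sum.distrib sum.delta')
qed

text \<open>In a sum of \<open>vars3 i * B i\<close>, differentiating the variables reproduces the
  form once, and differentiating the \<open>B i\<close> gives it another \<open>n\<close> times by
  induction.\<close>

lemma euler_form3:
  "form3 n A \<Longrightarrow> (\<Sum>j<3. vars3 j * pd3 j A) = of_nat n * A"
proof (induction rule: form3_induct)
  case (const c)
  then show ?case by (simp add: pd3_const)
next
  case (step n B)
  have "(\<Sum>j<3. vars3 j * pd3 j (\<Sum>i<3. vars3 i * B i))
      = (\<Sum>j<3. vars3 j * B j) + (\<Sum>j<3. \<Sum>i<3. vars3 i * (vars3 j * pd3 j (B i)))"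
    by (simp add: pd3_lincomb distrib_left sum.distrib sum_distrib_left mult.left_commute)
  also have "(\<Sum>j<3. \<Sum>i<3. vars3 i * (vars3 j * pd3 j (B i))) = (\<Sum>i<3. vars3 i * (of_nat n * B i))"
    by (subst sum.swap) (simp add: step.IH flip: sum_distrib_left)
  also have "\<dots> = of_nat n * (\<Sum>i<3. vars3 i * B i)"
    by (simp add: sum_distrib_left mult.left_commute)
  finally show ?case by (simp add: algebra_simps)
qed

lemma euler_form3_at:
  assumes "form3 n A"
  shows "(\<Sum>j<3. p j * eval3 id (pd3 j A) p) = of_nat n * eval3 id A p"
proof -
  interpret comm_ring_hom "\<lambda>A. eval3 id A p"
    by (intro comm_ring_hom_eval3 comm_ring_hom_id)
  show ?thesis
    using arg_cong[OF euler_form3[OF assms], of "\<lambda>A. eval3 id A p"]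
    by (simp add: hom_sum hom_mult hom_of_nat eval3_vars comm_ring_hom_id del: of_nat_Suc)
qed

subsection \<open>Coordinates adapted to a point and a line through it\<close>

text \<open>In the coordinates \<open>l0\<close>, \<open>l\<close>, \<open>m\<close> the point is
  (1:0:0), so every monomial except the pure power of \<open>l0\<close> is divisible by
  \<open>l\<close> or \<open>m\<close>. The induction rewrites one variable at a time in these
  coordinates.\<close>

lemma form3_expand:
  assumes form: "form3 1 l0" "form3 1 l" "form3 1 m"
    and eval: "eval3 id l0 p = 1" "eval3 id l p = 0" "eval3 id m p = 0"
    and vars: "\<And>i. i < 3 \<Longrightarrow> vars3 i = const3 (p i) * l0 + const3 (a i) * l + const3 (b i) * m"
    and "form3 (Suc n) A"
  obtains B C where "form3 n B" "form3 n C" "A = const3 (eval3 id A p) * l0 ^ Suc n + l * B + m * C"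
proof -
  interpret ev: comm_ring_hom "\<lambda>A. eval3 id A p"
    by (intro comm_ring_hom_eval3 comm_ring_hom_id)
  interpret c: comm_ring_hom const3 by (rule comm_ring_hom_const3)
  \<comment> \<open>The induction needs degree 0 as well; there no cofactors of degree
    \<open>n - 1\<close> exist, and they are required to be 0.\<close>
  have "\<exists>B C. A = const3 (eval3 id A p) * l0 ^ n + l * B + m * C \<and>
          (if n = 0 then B = 0 \<and> C = 0 else form3 (n - 1) B \<and> form3 (n - 1) C)"
    if "form3 n A" for n A
    using that
  proof (induction rule: form3_induct)
    case (const c)
    show ?case by (intro exI[of _ 0]) (simp add: eval3_const[OF comm_ring_hom_id] del: id_apply, simp)
  next
    case (step n A)
    obtain B C where
      eq: "\<And>i. i < 3 \<Longrightarrow> A i = const3 (eval3 id (A i) p) * l0 ^ n + l * B i + m * C i" and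
      BC: "\<And>i. i < 3 \<Longrightarrow> if n = 0 then B i = 0 \<and> C i = 0 else form3 (n - 1) (B i) \<and> form3 (n - 1) (C i)"
      using step.IH by metis
    define e where "e i = eval3 id (A i) p" for i
    have split: "vars3 i * A i = const3 (p i * e i) * l0 ^ Suc n
       + l * (const3 (a i * e i) * l0 ^ n + vars3 i * B i)
       + m * (const3 (b i * e i) * l0 ^ n + vars3 i * C i)" if "i < 3" for i
    proof -
      have "vars3 i * A i = vars3 i * (const3 (e i) * l0 ^ n) + l * (vars3 i * B i) + m * (vars3 i * C i)"
        by (subst eq[OF that]) (simp only: e_def algebra_simps)
      also have "vars3 i * (const3 (e i) * l0 ^ n) = const3 (p i * e i) * l0 ^ Suc n
         + l * (const3 (a i * e i) * l0 ^ n) + m * (const3 (b i * e i) * l0 ^ n)"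
        by (subst vars[OF that]) (simp only: algebra_simps c.hom_mult power_Suc)
      finally show ?thesis by (simp only: algebra_simps)
    qed
    have e: "eval3 id (\<Sum>i<3. vars3 i * A i) p = (\<Sum>i<3. p i * e i)"
      by (simp add: ev.hom_sum ev.hom_mult eval3_vars comm_ring_hom_id e_def)
    have "(\<Sum>i<3. vars3 i * A i) = const3 (\<Sum>i<3. p i * e i) * l0 ^ Suc n
       + l * (\<Sum>i<3. const3 (a i * e i) * l0 ^ n + vars3 i * B i)
       + m * (\<Sum>i<3. const3 (b i * e i) * l0 ^ n + vars3 i * C i)"
      unfolding c.hom_sum sum_distrib_left sum_distrib_right sum.distrib[symmetric]
      by (intro sum.cong refl) (simp only: split lessThan_iff)
    moreover have "form3 n (const3 c * l0 ^ n)" for c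
      using form3_power[OF form(1), of n] by (intro form3_const_mult) simp
    moreover have "form3 n (vars3 i * B i) \<and> form3 n (vars3 i * C i)" if "i < 3" for i
      using BC[OF that] form3_vars_mult[OF _ that, of "n - 1"] by (cases n) auto
    ultimately show ?case
      unfolding e
      by (intro exI[of _ "\<Sum>i<3. const3 (a i * e i) * l0 ^ n + vars3 i * B i"]
          exI[of _ "\<Sum>i<3. const3 (b i * e i) * l0 ^ n + vars3 i * C i"] conjI)
        (auto intro!: form3_sum form3_add simp del: mult_pCons_left)
  qed
  from this[OF assms(8)] that show ?thesis by auto
qed

definition lin3 :: "(nat \<Rightarrow> complex) \<Rightarrow> tripoly" where
  "lin3 c = (\<Sum>i<3. const3 (c i) * vars3 i)"

lemma form3_lin3: "form3 1 (lin3 c)"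
  unfolding lin3_def by (intro form3_sum form3_const_mult form3_vars) auto

lemma eval3_lin3: "comm_ring_hom h \<Longrightarrow> eval3 h (lin3 c) y = (\<Sum>i<3. h (c i) * y i)"
proof -
  assume h: "comm_ring_hom h"
  interpret comm_ring_hom "\<lambda>A. eval3 h A y"
    by (intro comm_ring_hom_eval3 h)
  show ?thesis
    by (simp add: lin3_def hom_sum hom_mult eval3_vars eval3_const h del: mult_pCons_left)
qed

lemma sum_lessThan_3: "(\<Sum>i<3. f i) = f 0 + f 1 + f (2::nat)" for f :: "nat \<Rightarrow> 'a::comm_monoid_add"
  by (simp add: eval_nat_numeral lessThan_Suc add_ac)

text \<open>With \<open>c \<bullet> p = b \<bullet> t = 1\<close> and \<open>t \<bullet> p = c \<bullet> b = 0\<close>, the covectors \<open>c\<close>, \<open>p \<times> b\<close>, \<open>t\<close> are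
  dual to the vectors \<open>p\<close>, \<open>c \<times> t\<close>, \<open>b\<close>.\<close>

lemma adapted_coordinates:
  fixes p t :: "nat \<Rightarrow> complex"
  assumes p: "\<exists>i<3. p i \<noteq> 0" and t: "\<exists>i<3. t i \<noteq> 0" and tp: "(\<Sum>i<3. t i * p i) = 0"
  obtains c l a b where "eval3 id (lin3 c) p = 1" "eval3 id (lin3 l) p = 0"
    "\<forall>i<3. vars3 i = const3 (p i) * lin3 c + const3 (a i) * lin3 l + const3 (b i) * lin3 t"
    "(\<Sum>i<3. l i * a i) = 1" "(\<Sum>i<3. t i * a i) = 0"
proof -
  have dual: "\<exists>c. (\<Sum>i<3. c i * v i) = 1" if "\<exists>i<3. v i \<noteq> 0" for v :: "nat \<Rightarrow> complex"
  proof -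
    from that obtain j where "j < 3" "v j \<noteq> 0" by auto
    then have "(\<Sum>i<3. (if i = j then 1 / v j else 0) * v i) = 1"
      by (simp add: if_distrib[of "\<lambda>x. x * _"] cong: if_cong)
    then show ?thesis by (rule exI[of _ "\<lambda>i. if i = j then 1 / v j else 0"])
  qed
  obtain c' where c': "(\<Sum>i<3. c' i * p i) = 1" using dual[OF p] ..
  obtain b where b: "(\<Sum>i<3. b i * t i) = 1" using dual[OF t] ..
  \<comment> \<open>Subtracting a multiple of \<open>t\<close> makes \<open>c\<close> vanish on
    \<open>b\<close> and keeps the value 1 at \<open>p\<close>, since \<open>t\<close> vanishes
    there.\<close>
  define c where "c i = c' i - (\<Sum>j<3. c' j * b j) * t i" for i
  define l where "l i = [p 1 * b 2 - p 2 * b 1, p 2 * b 0 - p 0 * b 2, p 0 * b 1 - p 1 * b 0] ! i" for i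
  define a where "a i = [c 1 * t 2 - c 2 * t 1, c 2 * t 0 - c 0 * t 2, c 0 * t 1 - c 1 * t 0] ! i" for i
  have cp: "(\<Sum>i<3. c i * p i) = 1"
    using c' tp by (simp add: c_def left_diff_distrib sum_subtractf mult.assoc flip: sum_distrib_left)
  have cb: "(\<Sum>i<3. c i * b i) = 0"
    using b by (simp add: c_def left_diff_distrib sum_subtractf mult.assoc mult.commute[of "t _"]
        flip: sum_distrib_left)
  have lp: "(\<Sum>i<3. l i * p i) = 0" and ta: "(\<Sum>i<3. t i * a i) = 0" and lb: "(\<Sum>i<3. l i * b i) = 0"
    and ca: "(\<Sum>i<3. c i * a i) = 0"
    unfolding sum_lessThan_3 l_def a_def by (simp_all add: algebra_simps)
  \<comment> \<open>This is the Binet-Cauchy identity for the scalar product of two cross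
    products.\<close>
  have la: "(\<Sum>i<3. l i * a i) = (\<Sum>i<3. c i * p i) * (\<Sum>i<3. b i * t i) - (\<Sum>i<3. t i * p i) * (\<Sum>i<3. c i * b i)"
    unfolding sum_lessThan_3 l_def a_def by (simp add: algebra_simps)
  define N where "N = mat 3 3 (\<lambda>(r, i). ([c, l, t] ! r) i)"
  define M where "M = mat 3 3 (\<lambda>(i, r). ([p, a, b] ! r) i)"
  have "N * M = 1\<^sub>m 3"
  proof (rule eq_matI)
    fix i j assume "i < dim_row (1\<^sub>m 3 :: complex mat)" "j < dim_col (1\<^sub>m 3 :: complex mat)"
    then have "i = 0 \<or> i = 1 \<or> i = 2" "j = 0 \<or> j = 1 \<or> j = 2" by auto
    then show "(N * M) $$ (i, j) = 1\<^sub>m 3 $$ (i, j)"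
      using cp cb lp ta lb ca la b tp
      by (auto simp: N_def M_def scalar_prod_def mult.commute atLeast0LessThan)
  qed (simp_all add: N_def M_def)
  \<comment> \<open>Duality of the two bases says that \<open>N\<close> is a left inverse of
    \<open>M\<close>; as a right inverse it decomposes each variable along the three
    covectors.\<close>
  then have MN: "M * N = 1\<^sub>m 3"
    by (intro mat_mult_left_right_inverse[of N]) (auto simp: N_def M_def)
  have *: "p i * c j + a i * l j + b i * t j = (if i = j then 1 else 0)" if "i < 3" "j < 3" for i j
  proof -
    have "p i * c j + a i * l j + b i * t j = (M * N) $$ (i, j)"
      using that by (simp add: N_def M_def scalar_prod_def atLeast0LessThan sum_lessThan_3)
    then show ?thesis using that by (simp add: MN)
  qed
  interpret k: comm_ring_hom const3 by (rule comm_ring_hom_const3)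
  show ?thesis
  proof
    show "eval3 id (lin3 c) p = 1" "eval3 id (lin3 l) p = 0"
      using cp lp by (simp_all add: eval3_lin3 comm_ring_hom_id)
    show "(\<Sum>i<3. l i * a i) = 1" "(\<Sum>i<3. t i * a i) = 0"
      using la cp b tp ta by simp_all
    show "\<forall>i<3. vars3 i = const3 (p i) * lin3 c + const3 (a i) * lin3 l + const3 (b i) * lin3 t"
    proof (intro allI impI)
      fix i :: nat assume i: "i < 3"
      have "const3 (p i) * lin3 c + const3 (a i) * lin3 l + const3 (b i) * lin3 t
          = (\<Sum>j<3. const3 (p i * c j + a i * l j + b i * t j) * vars3 j)"
        unfolding lin3_def k.hom_add k.hom_mult distrib_right sum.distrib sum_distrib_left mult.assoc ..
      also have "\<dots> = (\<Sum>j<3. if i = j then vars3 j else 0)"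
        using *[OF i] by (intro sum.cong) (auto simp flip: one_pCons)
      finally show "vars3 i = const3 (p i) * lin3 c + const3 (a i) * lin3 l + const3 (b i) * lin3 t"
        using i by simp
    qed
  qed
qed

subsection \<open>Multiplicities in a local ring with a uniformizer\<close>

lemma fps_X_power_dvd_iff: "fps_X ^ n dvd g \<longleftrightarrow> (\<forall>k<n. g $ k = 0)" for g :: "'a::comm_ring_1 fps"
proof
  assume "\<forall>k<n. g $ k = 0"
  then have "g = fps_X ^ n * Abs_fps (\<lambda>i. g $ (i + n))"
    by (auto simp: fps_eq_iff fps_X_power_mult_nth)
  then show "fps_X ^ n dvd g" by (rule dvdI)
qed (auto simp: fps_X_power_mult_nth elim!: dvdE)

text \<open>There are fewer equations than unknowns. Zero rows pad the system to a square matrix,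
  whose determinant vanishes by expansion along a zero row.\<close>

lemma linear_dependence:
  fixes e :: "'b \<Rightarrow> nat \<Rightarrow> 'a::field"
  assumes "finite B" "k < card B"
  obtains \<gamma> where "\<And>i. i < k \<Longrightarrow> (\<Sum>b\<in>B. \<gamma> b * e b i) = 0" "\<exists>b\<in>B. \<gamma> b \<noteq> 0"
proof -
  define n where "n = card B"
  obtain h where h: "bij_betw h {..<n} B"
    using ex_bij_betw_nat_finite[OF assms(1)] by (auto simp: n_def atLeast0LessThan)
  define M where "M = mat n n (\<lambda>(r, j). if r < k then e (h j) r else 0)"
  have M: "M \<in> carrier_mat n n" by (simp add: M_def)
  have "det M = (\<Sum>j<n. M $$ (k, j) * cofactor M k j)"
    using assms(2) by (intro laplace_expansion_row[OF M]) (simp add: n_def)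
  also have "\<dots> = 0"
    using assms(2) by (intro sum.neutral) (simp add: M_def n_def)
  finally obtain v where v: "v \<in> carrier_vec n" "v \<noteq> 0\<^sub>v n" "M *\<^sub>v v = 0\<^sub>v n"
    using det_0_iff_vec_prod_zero[OF M] by auto
  define \<gamma> where "\<gamma> b = v $ (the_inv_into {..<n} h b)" for b
  have \<gamma>: "\<gamma> (h j) = v $ j" if "j < n" for j
    using that h by (simp add: \<gamma>_def the_inv_into_f_f bij_betw_def)
  show ?thesis
  proof
    fix i assume i: "i < k"
    have "(\<Sum>b\<in>B. \<gamma> b * e b i) = (\<Sum>j<n. v $ j * e (h j) i)"
      by (subst sum.reindex_bij_betw[OF h, symmetric]) (simp add: \<gamma>)
    also have "\<dots> = (M *\<^sub>v v) $ i"
      using i assms(2) v(1)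
      by (auto simp: M_def scalar_prod_def n_def atLeast0LessThan mult.commute intro!: sum.cong)
    finally show "(\<Sum>b\<in>B. \<gamma> b * e b i) = 0"
      using i assms(2) v(3) by (simp add: n_def)
  next
    obtain j where "j < n" "v $ j \<noteq> 0"
      using v(1,2) by (auto simp: vec_eq_iff)
    then show "\<exists>b\<in>B. \<gamma> b \<noteq> 0"
      using h \<gamma> by (metis bij_betwE lessThan_iff)
  qed
qed

no_notation vec_index (infixl \<open>$\<close> 100)

text \<open>The model is the local ring of a curve at a smooth point, with local equation \<open>f\<close> and
  uniformizer \<open>x\<close>; \<open>ev\<close> is the pullback along a parametrized branch.\<close>

locale local_branch =
  fixes R :: "'k::field set" and \<iota> :: "complex \<Rightarrow> 'k" and ev :: "'k \<Rightarrow> complex fps" and x f :: 'k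
  assumes add_closed: "a \<in> R \<Longrightarrow> b \<in> R \<Longrightarrow> a + b \<in> R"
    and mult_closed: "a \<in> R \<Longrightarrow> b \<in> R \<Longrightarrow> a * b \<in> R"
    and const_closed: "\<iota> c \<in> R"
    and inverse_closed: "a \<in> R \<Longrightarrow> ev a $ 0 \<noteq> 0 \<Longrightarrow> inverse a \<in> R"
    and hom_const: "comm_ring_hom \<iota>"
    and ev_add: "a \<in> R \<Longrightarrow> b \<in> R \<Longrightarrow> ev (a + b) = ev a + ev b"
    and ev_mult: "a \<in> R \<Longrightarrow> b \<in> R \<Longrightarrow> ev (a * b) = ev a * ev b"
    and ev_const: "ev (\<iota> c) = fps_const c"
    and x_closed: "x \<in> R" and f_closed: "f \<in> R"
    and ev_x: "ev x $ 0 = 0" and ev_f: "ev f = 0"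
    and decomp: "a \<in> R \<Longrightarrow> ev a $ 0 = 0 \<Longrightarrow> \<exists>g\<in>R. \<exists>h\<in>R. a = x * g + f * h"
begin

sublocale const: comm_ring_hom \<iota> by (rule hom_const)

lemma zero_closed: "0 \<in> R" and one_closed: "1 \<in> R"
  using const_closed[of 0] const_closed[of 1] by simp_all

lemma uminus_closed: "a \<in> R \<Longrightarrow> - a \<in> R"
  using mult_closed[OF const_closed[of "- 1"], of a] by (simp add: const.hom_uminus)

lemma diff_closed: "a \<in> R \<Longrightarrow> b \<in> R \<Longrightarrow> a - b \<in> R"
  using add_closed[of a "- b"] uminus_closed[of b] by simp

lemma sum_closed: "(\<And>i. i \<in> I \<Longrightarrow> a i \<in> R) \<Longrightarrow> (\<Sum>i\<in>I. a i) \<in> R"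
  by (induction I rule: infinite_finite_induct) (auto intro: zero_closed add_closed)

lemma power_closed: "a \<in> R \<Longrightarrow> a ^ n \<in> R"
  by (induction n) (auto intro: one_closed mult_closed)

lemma ev_0: "ev 0 = 0" and ev_1: "ev 1 = 1"
  using ev_const[of 0] ev_const[of 1] by simp_all

lemma ev_uminus: "a \<in> R \<Longrightarrow> ev (- a) = - ev a"
  using ev_add[of a "- a"] uminus_closed[of a] by (simp add: ev_0 eq_neg_iff_add_eq_0 add.commute)

lemma ev_diff: "a \<in> R \<Longrightarrow> b \<in> R \<Longrightarrow> ev (a - b) = ev a - ev b"
  using ev_add[of a "- b"] ev_uminus[of b] uminus_closed[of b] by simp

lemma ev_sum: "(\<And>i. i \<in> I \<Longrightarrow> a i \<in> R) \<Longrightarrow> ev (\<Sum>i\<in>I. a i) = (\<Sum>i\<in>I. ev (a i))"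
  by (induction I rule: infinite_finite_induct) (auto simp: ev_0 ev_add sum_closed)

lemma ev_power: "a \<in> R \<Longrightarrow> ev (a ^ n) = ev a ^ n"
  by (induction n) (auto simp: ev_1 ev_mult power_closed)

lemma ev_xf: "g \<in> R \<Longrightarrow> h \<in> R \<Longrightarrow> ev (x * g + f * h) = ev x * ev g"
  by (simp add: ev_add ev_mult mult_closed x_closed f_closed ev_f)

text \<open>All orders of pullbacks are multiples of the order of the pullback of \<open>x\<close>; so two consecutive
  orders force the latter to be 1.\<close>

lemma ev_x_order_1:
  assumes "b \<in> R" "b' \<in> R" "ev b \<noteq> 0" "ev b' = fps_X * ev b"
  shows "ev x $ 1 \<noteq> 0"
  using assms
proof (induction "subdegree (ev b)" arbitrary: b b' rule: less_induct)
  case less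
  have "ev b' $ 0 = 0" using less.prems by simp
  then obtain g' h' where g': "g' \<in> R" "h' \<in> R" "b' = x * g' + f * h'"
    using decomp less.prems by meson
  show ?case
  proof (cases "ev b $ 0 = 0")
    \<comment> \<open>If \<open>b\<close> is a unit, then \<open>b'\<close> has order exactly 1,
      while it is also \<open>x\<close> times a ring element modulo \<open>f\<close>.\<close>
    case False
    have "ev b' $ 1 = ev x $ 1 * ev g' $ 0"
      using g' by (simp add: ev_xf fps_mult_nth_1 ev_x)
    moreover have "ev b' $ 1 = ev b $ 0"
      using less.prems by simp
    ultimately show ?thesis using False by auto
  next
    \<comment> \<open>Otherwise \<open>x\<close> divides both \<open>b\<close> and \<open>b'\<close>
      modulo \<open>f\<close>; the quotients keep the ratio \<open>fps_X\<close> and have smaller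
      order.\<close>
    case True
    then obtain g h where g: "g \<in> R" "h \<in> R" "b = x * g + f * h"
      using decomp less.prems by meson
    have b: "ev b = ev x * ev g" using g by (simp add: ev_xf)
    with less.prems have nz: "ev x \<noteq> 0" "ev g \<noteq> 0" by auto
    have "ev x * ev g' = ev x * (fps_X * ev g)"
      using less.prems(4) g' b by (simp add: ev_xf)
    with nz have "ev g' = fps_X * ev g" by simp
    moreover have "subdegree (ev g) < subdegree (ev b)"
      using nz ev_x by (simp add: b subdegree_eq_0_iff neq0_conv[symmetric] del: neq0_conv)
    ultimately show ?thesis using less.hyps g g' nz by blast
  qed
qed

end

section \<open>Residues modulo a curve, counted by powers of a uniformizer\<close>

locale local_smooth_branch = local_branch +
  assumes ev_x_1: "ev x $ 1 \<noteq> 0"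
begin

lemma subdegree_ev_x: "subdegree (ev x) = 1"
  by (rule subdegreeI) (use ev_x ev_x_1 in auto)

lemma ev_x_nonzero: "ev x \<noteq> 0"
  using ev_x_1 by auto

text \<open>A Taylor expansion in the uniformizer modulo \<open>f\<close>: the remainder minus its
  value at the point is again divisible by \<open>x\<close> modulo \<open>f\<close>.\<close>

lemma expansion:
  assumes "a \<in> R"
  shows "\<exists>c. \<exists>g\<in>R. \<exists>h\<in>R. a = (\<Sum>i<k. \<iota> (c i) * x ^ i) + x ^ k * g + f * h"
proof (induction k)
  case 0
  show ?case using assms zero_closed by (intro exI bexI[of _ a] bexI[of _ 0]) auto
next
  case (Suc k)
  then obtain c g h where gh: "g \<in> R" "h \<in> R" "a = (\<Sum>i<k. \<iota> (c i) * x ^ i) + x ^ k * g + f * h"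
    by blast
  define e where "e = ev g $ 0"
  have "ev (g - \<iota> e) $ 0 = 0"
    using gh by (simp add: ev_diff const_closed ev_const e_def)
  then obtain g' h' where gh': "g' \<in> R" "h' \<in> R" "g - \<iota> e = x * g' + f * h'"
    using decomp[of "g - \<iota> e"] gh const_closed diff_closed by meson
  have g: "g = \<iota> e + x * g' + f * h'"
    using gh'(3) by (simp add: algebra_simps)
  have "a = (\<Sum>i<Suc k. \<iota> ((c(k := e)) i) * x ^ i) + x ^ Suc k * g' + f * (h + x ^ k * h')"
    by (simp add: gh(3) g algebra_simps)
  then show ?case
    using gh gh' by (intro exI[of _ "c(k := e)"] bexI[of _ g'] bexI[of _ "h + x ^ k * h'"])
      (auto intro!: add_closed mult_closed power_closed x_closed simp del: fun_upd_apply)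
qed

text \<open>Since \<open>x\<close> pulls back to order 1, a quotient whose pullback still has
  positive order vanishes at the point and can be divided by \<open>x\<close> once more.\<close>

lemma vanishing:
  assumes "a \<in> R" "ev a \<noteq> 0" "k \<le> subdegree (ev a)"
  shows "\<exists>g\<in>R. \<exists>h\<in>R. a = x ^ k * g + f * h"
  using assms(3)
proof (induction k)
  case 0
  show ?case using assms zero_closed by (intro bexI[of _ a] bexI[of _ 0]) auto
next
  case (Suc k)
  then obtain g h where gh: "g \<in> R" "h \<in> R" "a = x ^ k * g + f * h" by auto
  have a: "ev a = ev x ^ k * ev g"
    using gh by (simp add: ev_add ev_mult ev_power mult_closed power_closed x_closed f_closed ev_f)
  with assms(2) have "ev g \<noteq> 0" by auto
  with a Suc.prems have "0 < subdegree (ev g)"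
    by (simp add: ev_x_nonzero subdegree_ev_x)
  then have "ev g $ 0 = 0" by auto
  then obtain g' h' where gh': "g' \<in> R" "h' \<in> R" "g = x * g' + f * h'"
    using decomp gh by meson
  have "a = x ^ Suc k * g' + f * (h + x ^ k * h')"
    by (simp add: gh(3) gh'(3) algebra_simps)
  then show ?case
    using gh gh' by (intro bexI[of _ g'] bexI[of _ "h + x ^ k * h'"])
      (auto intro!: add_closed mult_closed power_closed x_closed)
qed

text \<open>If \<open>g\<close> pulls back to order \<open>k\<close>, it is a unit times
  \<open>x ^ k\<close> modulo \<open>f\<close>. Hence \<open>x ^ k\<close> lies in the ideal of
  \<open>g\<close> and \<open>f\<close>, and the Taylor expansion can be cut off there.\<close>

lemma residue:
  assumes "g \<in> R" "ev g \<noteq> 0" "a \<in> R"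
  shows "\<exists>c. \<exists>h\<in>R. \<exists>h'\<in>R. a = (\<Sum>i<subdegree (ev g). \<iota> (c i) * x ^ i) + g * h + f * h'"
proof -
  define k where "k = subdegree (ev g)"
  obtain q h where qh: "q \<in> R" "h \<in> R" "g = x ^ k * q + f * h"
    using vanishing[OF assms(1,2)] k_def by blast
  have g: "ev g = ev x ^ k * ev q"
    using qh by (simp add: ev_add ev_mult ev_power mult_closed power_closed x_closed f_closed ev_f)
  with assms(2) have "ev q \<noteq> 0" by auto
  moreover have "subdegree (ev q) = 0"
    using arg_cong[OF g, of subdegree] \<open>ev q \<noteq> 0\<close> by (simp add: ev_x_nonzero subdegree_ev_x k_def)
  ultimately have q0: "ev q $ 0 \<noteq> 0" by (simp add: subdegree_eq_0_iff)
  then have iq: "inverse q \<in> R" "q \<noteq> 0"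
    using qh(1) inverse_closed ev_0 by auto
  have xk: "x ^ k = g * inverse q + f * (- h * inverse q)"
    using iq(2) by (simp add: qh(3) field_simps)
  obtain c b h' where b: "b \<in> R" "h' \<in> R" "a = (\<Sum>i<k. \<iota> (c i) * x ^ i) + x ^ k * b + f * h'"
    using expansion[OF assms(3)] by blast
  have a: "a = (\<Sum>i<k. \<iota> (c i) * x ^ i) + g * (inverse q * b) + f * (h' + - h * inverse q * b)"
    by (simp only: b(3) xk algebra_simps)
  moreover have "inverse q * b \<in> R" "h' + - h * inverse q * b \<in> R"
    using b(1,2) qh(2) iq(1) by (simp_all only: add_closed mult_closed uminus_closed)
  ultimately show ?thesis
    unfolding k_def[symmetric] by blast
qed

text \<open>The residues lie in the span of \<open>k\<close> powers of \<open>x\<close>, where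
  \<open>k\<close> is the order of \<open>g\<close>. More than \<open>k\<close> elements therefore
  have a nontrivial combination in the ideal of \<open>g\<close> and \<open>f\<close>, hence in
  \<open>J\<close>.\<close>

lemma card_independent_le:
  assumes g: "g \<in> R" "ev g \<noteq> 0" and B: "finite B" "B \<subseteq> R"
    and J: "\<And>h h'. h \<in> R \<Longrightarrow> h' \<in> R \<Longrightarrow> g * h + f * h' \<in> J"
    and indep: "\<And>c. (\<Sum>b\<in>B. \<iota> (c b) * b) \<in> J \<Longrightarrow> \<forall>b\<in>B. c b = 0"
  shows "card B \<le> subdegree (ev g)"
proof (rule ccontr)
  define k where "k = subdegree (ev g)"
  assume "\<not> card B \<le> subdegree (ev g)"
  then have less: "k < card B" by (simp add: k_def)
  have "\<exists>c h h'. h \<in> R \<and> h' \<in> R \<and> b = (\<Sum>i<k. \<iota> (c i) * x ^ i) + g * h + f * h'" if "b \<in> B" for b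
    using residue[OF g, of b] that B(2) unfolding k_def by blast
  then obtain c h h' where ch: "\<And>b. b \<in> B \<Longrightarrow> h b \<in> R" "\<And>b. b \<in> B \<Longrightarrow> h' b \<in> R"
    "\<And>b. b \<in> B \<Longrightarrow> b = (\<Sum>i<k. \<iota> (c b i) * x ^ i) + g * h b + f * h' b"
    by metis
  obtain \<gamma> where \<gamma>: "\<And>i. i < k \<Longrightarrow> (\<Sum>b\<in>B. \<gamma> b * c b i) = 0" "\<exists>b\<in>B. \<gamma> b \<noteq> 0"
    using linear_dependence[OF B(1) less, of c] by auto
  have "(\<Sum>b\<in>B. \<iota> (\<gamma> b) * b) = (\<Sum>b\<in>B. (\<Sum>i<k. \<iota> (\<gamma> b * c b i) * x ^ i)
      + g * (\<iota> (\<gamma> b) * h b) + f * (\<iota> (\<gamma> b) * h' b))"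
  proof (rule sum.cong[OF refl])
    fix b assume "b \<in> B"
    have "\<iota> (\<gamma> b) * b = \<iota> (\<gamma> b) * ((\<Sum>i<k. \<iota> (c b i) * x ^ i) + g * h b + f * h' b)"
      using ch(3)[OF \<open>b \<in> B\<close>] by simp
    then show "\<iota> (\<gamma> b) * b = (\<Sum>i<k. \<iota> (\<gamma> b * c b i) * x ^ i)
      + g * (\<iota> (\<gamma> b) * h b) + f * (\<iota> (\<gamma> b) * h' b)"
      by (simp add: algebra_simps sum_distrib_left const.hom_mult)
  qed
  also have "\<dots> = (\<Sum>i<k. \<iota> (\<Sum>b\<in>B. \<gamma> b * c b i) * x ^ i)
      + g * (\<Sum>b\<in>B. \<iota> (\<gamma> b) * h b) + f * (\<Sum>b\<in>B. \<iota> (\<gamma> b) * h' b)"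
    by (simp add: sum.distrib sum_distrib_left sum_distrib_right const.hom_sum sum.swap[of _ B])
  also have "\<dots> = g * (\<Sum>b\<in>B. \<iota> (\<gamma> b) * h b) + f * (\<Sum>b\<in>B. \<iota> (\<gamma> b) * h' b)"
    by (simp add: \<gamma>(1))
  also have "\<dots> \<in> J"
    using ch by (intro J sum_closed mult_closed const_closed) auto
  finally show False using indep \<gamma>(2) by blast
qed

text \<open>The system for the coefficients is triangular: lower powers drop out by induction,
  higher powers have too large an order, and the diagonal entry is a power of the nonzero linear
  coefficient of \<open>ev x\<close>.\<close>

lemma powers_independent:
  assumes "fps_X ^ n dvd ev (\<Sum>i<n. \<iota> (c i) * x ^ i)" "i < n"
  shows "c i = 0"
  using assms(2)
proof (induction i rule: less_induct)
  case (less i)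
  have ev: "ev (\<Sum>i<n. \<iota> (c i) * x ^ i) = (\<Sum>j<n. fps_const (c j) * ev x ^ j)"
    by (simp add: ev_sum ev_mult ev_power ev_const mult_closed const_closed power_closed x_closed)
  have "(fps_const (c j) * ev x ^ j) $ i = (if j = i then c i * (ev x $ 1) ^ i else 0)" if "j < n" for j
  proof (cases j i rule: linorder_cases)
    case less
    then show ?thesis using less.IH that by auto
  next
    case equal
    then show ?thesis using startsby_zero_power_nth_same[OF ev_x, of i] by simp
  next
    case greater
    then show ?thesis using startsby_zero_power_prefix[OF ev_x, of j] by simp
  qed
  then have "(\<Sum>j<n. fps_const (c j) * ev x ^ j) $ i = c i * (ev x $ 1) ^ i"
    using less.prems by (simp add: fps_sum_nth)
  moreover have "(\<Sum>j<n. fps_const (c j) * ev x ^ j) $ i = 0"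
    using assms(1) less.prems unfolding ev by (auto simp: fps_X_power_mult_nth elim!: dvdE)
  ultimately show ?case using ev_x_1 by simp
qed

text \<open>The first \<open>n\<close> powers of \<open>x\<close> serve: a combination in
  \<open>J\<close> would have a pullback of order at least \<open>n\<close>. They are pairwise
  distinct since their pullbacks have distinct orders.\<close>

lemma ex_independent:
  assumes "\<And>b. b \<in> J \<Longrightarrow> fps_X ^ n dvd ev b"
  shows "\<exists>B. finite B \<and> B \<subseteq> R \<and> card B = n \<and>
           (\<forall>c. (\<Sum>b\<in>B. \<iota> (c b) * b) \<in> J \<longrightarrow> (\<forall>b\<in>B. c b = 0))"
proof (intro exI conjI allI impI ballI)
  have inj: "inj_on (\<lambda>i. x ^ i) {..<n}"
  proof (rule inj_onI)
    fix i j assume "x ^ i = x ^ j"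
    from arg_cong[OF this, of "\<lambda>y. subdegree (ev y)"] show "i = j"
      by (simp add: ev_power x_closed subdegree_ev_x)
  qed
  show "card ((\<lambda>i. x ^ i) ` {..<n}) = n" using inj by (simp add: card_image)
  show "(\<lambda>i. x ^ i) ` {..<n} \<subseteq> R" by (auto intro: power_closed x_closed)
  fix c b
  assume "(\<Sum>b\<in>(\<lambda>i. x ^ i) ` {..<n}. \<iota> (c b) * b) \<in> J" and b: "b \<in> (\<lambda>i. x ^ i) ` {..<n}"
  then have "(\<Sum>i<n. \<iota> (c (x ^ i)) * x ^ i) \<in> J"
    using inj by (simp add: sum.reindex)
  from powers_independent[OF assms[OF this]] b show "c b = 0" by auto
qed simp

end

subsection \<open>Binary forms along a line\<close>

lemma form2_0 [simp]: "form2 n 0"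
  by (simp add: form2_def)

lemma form2_add: "form2 n A \<Longrightarrow> form2 n B \<Longrightarrow> form2 n (A + B)"
  unfolding form2_def by (metis add.right_neutral coeff_add)

lemma form2_sum: "(\<And>i. i \<in> I \<Longrightarrow> form2 n (A i)) \<Longrightarrow> form2 n (\<Sum>i\<in>I. A i)"
  by (induction I rule: infinite_finite_induct) (auto intro: form2_add)

lemma form2_const_mult: "form2 n A \<Longrightarrow> form2 n (const2 c * A)"
  by (auto simp: form2_def)

lemma form2_vars_mult:
  assumes "form2 n A" "i < 2"
  shows "form2 (Suc n) (vars2 i * A)"
proof -
  have X: "coeff ([:0, 1:] * P) k = (case k of 0 \<Rightarrow> 0 | Suc k \<Rightarrow> coeff P k)" for P :: "'a::comm_ring_1 poly" and k
    by (simp add: coeff_pCons)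
  have C: "coeff ([:c:] * P) k = c * coeff P k" for c and P :: "'a::comm_ring_1 poly" and k
    by simp
  from less_2_cases_nat[OF assms(2)] show ?thesis
    using assms(1)
    by (auto simp: form2_def vars2_def X C simp del: mult_pCons_left split: nat.splits)
qed

lemma form2_0E:
  assumes "form2 0 A"
  obtains c where "A = const2 c"
proof
  show "A = const2 (coeff (coeff A 0) 0)"
    using assms by (auto simp: poly_eq_iff form2_def coeff_pCons split: nat.splits)
qed

lemma form2_SucE:
  assumes "form2 (Suc n) A"
  obtains B where "\<And>i. i < 2 \<Longrightarrow> form2 n (B i)" "A = (\<Sum>i<2. vars2 i * B i)"
proof -
  obtain a A0 where A: "A = pCons a A0" by (cases A)
  obtain b a0 where a: "a = pCons b a0" by (cases a)
  have *: "coeff (coeff A i) j \<noteq> 0 \<Longrightarrow> i + j = Suc n" for i j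
    using assms by (simp add: form2_def)
  define B where "B i = [A0, [:a0:]] ! i" for i
  show ?thesis
  proof
    show "form2 n (B i)" if "i < 2" for i
      using less_2_cases_nat[OF that]
    proof (elim disjE)
      assume "i = 0" then show ?thesis
        using *[of "Suc _"] by (auto simp: form2_def B_def A)
    next
      assume "i = 1" then show ?thesis
        using *[of 0 "Suc _"] by (auto simp: form2_def B_def A a coeff_pCons split: nat.splits)
    qed
    have "b = 0"
      using *[of 0 0] by (auto simp: A a)
    then show "A = (\<Sum>i<2. vars2 i * B i)"
      by (simp add: eval_nat_numeral lessThan_Suc B_def vars2_def A a)
  qed
qed

lemma form2_induct [consumes 1, case_names const step]:
  assumes "form2 n A"
    and "\<And>c. P 0 (const2 c)"
    and "\<And>n B. (\<And>i. i < 2 \<Longrightarrow> form2 n (B i)) \<Longrightarrow> (\<And>i. i < 2 \<Longrightarrow> P n (B i)) \<Longrightarrow>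
           P (Suc n) (\<Sum>i<2. vars2 i * B i)"
  shows "P n A"
  using assms(1)
proof (induction n arbitrary: A)
  case 0
  then show ?case using assms(2) by (metis form2_0E)
next
  case (Suc n)
  then show ?case using assms(3) by (metis form2_SucE)
qed

lemma form2_mult:
  assumes "form2 m A" "form2 n B"
  shows "form2 (m + n) (A * B)"
  using assms(1)
proof (induction rule: form2_induct)
  case (const c)
  show ?case using form2_const_mult[OF assms(2)] by simp
next
  case (step m C)
  show ?case
    unfolding sum_distrib_right mult.assoc add_Suc
    by (intro form2_sum form2_vars_mult step) auto
qed

lemma form2_eval3:
  assumes "form3 n A" "\<And>i. i < 3 \<Longrightarrow> form2 d (\<phi> i)"
  shows "form2 (n * d) (eval3 const2 A \<phi>)"
  using assms(1)
proof (induction rule: form3_induct)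
  case (const c)
  show ?case
    unfolding eval3_const[OF comm_ring_hom_const2]
    by (auto simp: form2_def coeff_pCons split: nat.splits)
next
  case (step n B)
  interpret comm_ring_hom "\<lambda>A. eval3 const2 A \<phi>"
    by (intro comm_ring_hom_eval3 comm_ring_hom_const2)
  show ?case
    by (simp add: hom_sum hom_mult eval3_vars comm_ring_hom_const2)
      (auto intro!: form2_sum form2_mult assms(2) step.IH)
qed

lemma form2_pd_s: "form2 (Suc n) P \<Longrightarrow> form2 n (pd_s P)"
  by (fastforce simp: form2_def pd_s_def coeff_pderiv of_nat_poly simp del: of_nat_Suc)

lemma form2_pd_t: "form2 (Suc n) P \<Longrightarrow> form2 n (pd_t P)"
  by (fastforce simp: form2_def pd_t_def coeff_map_poly coeff_pderiv)

lemma pd_commute: "pd_t (pd_s P) = pd_s (pd_t P)"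
  by (intro poly_eqI) (simp add: pd_s_def pd_t_def coeff_map_poly coeff_pderiv mult.left_commute
      flip: of_nat_Suc of_nat_mult add: of_nat_poly)

lemma pd_t_power_commute: "(pd_t ^^ i) (pd_s P) = pd_s ((pd_t ^^ i) P)"
  by (induction i) (simp_all add: pd_commute)

lemma pd_const: "pd_s (const2 c) = 0" "pd_t (const2 c) = 0"
  by (simp_all add: pd_s_def pd_t_def Polynomial.map_poly_pCons pderiv_pCons)

lemma sum_lessThan_2: "(\<Sum>i<2. f i) = f 0 + f (1::nat)" for f :: "nat \<Rightarrow> 'a::comm_monoid_add"
  by (simp add: eval_nat_numeral lessThan_Suc add_ac)

lemma pd_s_lincomb: "pd_s (\<Sum>i<2. vars2 i * B i) = B 0 + (\<Sum>i<2. vars2 i * pd_s (B i))"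
  by (simp add: derivation_add[OF derivation_pd_s] derivation_mult[OF derivation_pd_s] eval_nat_numeral lessThan_Suc)
    (simp add: pd_s_def vars2_def pderiv_pCons flip: one_pCons)

lemma pd_t_lincomb: "pd_t (\<Sum>i<2. vars2 i * B i) = B 1 + (\<Sum>i<2. vars2 i * pd_t (B i))"
  by (simp add: derivation_add[OF derivation_pd_t] derivation_mult[OF derivation_pd_t] eval_nat_numeral lessThan_Suc)
    (simp add: pd_t_def vars2_def Polynomial.map_poly_pCons pderiv_pCons map_poly_1 flip: one_pCons)

lemma euler_form2:
  "form2 n P \<Longrightarrow> vars2 0 * pd_s P + vars2 1 * pd_t P = of_nat n * P"
proof (induction rule: form2_induct)
  case (const c)
  then show ?case by (simp add: pd_const)
next
  case (step n B)
  have "vars2 0 * pd_s (\<Sum>i<2. vars2 i * B i) + vars2 1 * pd_t (\<Sum>i<2. vars2 i * B i)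
      = (\<Sum>i<2. vars2 i * B i) + (\<Sum>i<2. vars2 i * (vars2 0 * pd_s (B i) + vars2 1 * pd_t (B i)))"
    unfolding pd_s_lincomb pd_t_lincomb by (simp only: sum_lessThan_2) (simp only: algebra_simps)
  also have "\<dots> = (\<Sum>i<2. vars2 i * B i) + (\<Sum>i<2. vars2 i * (of_nat n * B i))"
    by (intro arg_cong2[of _ _ _ _ "(+)"] sum.cong refl) (simp only: step.IH lessThan_iff)
  also have "\<dots> = of_nat (Suc n) * (\<Sum>i<2. vars2 i * B i)"
    by (simp add: sum_distrib_left distrib_right distrib_left sum.distrib mult.left_commute del: mult_pCons_left)
  finally show ?case .
qed

section \<open>Restriction of binary forms to a line through \<open>u\<close>\<close>

definition line :: "(nat \<Rightarrow> complex) \<Rightarrow> (nat \<Rightarrow> complex) \<Rightarrow> nat \<Rightarrow> complex fps" where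
  "line u v k = fps_const (u k) + fps_const (v k) * fps_X"

text \<open>Values are power series rather than polynomials, so that denominators not vanishing at
  the point become invertible.\<close>

definition along :: "(nat \<Rightarrow> complex) \<Rightarrow> (nat \<Rightarrow> complex) \<Rightarrow> bipoly \<Rightarrow> complex fps" where
  "along u v P = eval2 fps_const P (line u v)"

lemma comm_ring_hom_along: "comm_ring_hom (along u v)"
  unfolding along_def by (intro comm_ring_hom_eval2 comm_ring_hom_fps_const)

lemma along_vars: "i < 2 \<Longrightarrow> along u v (vars2 i) = line u v i"
  by (simp add: along_def eval2_vars comm_ring_hom_fps_const)

lemma along_const: "along u v (const2 c) = fps_const c"
  by (simp add: along_def eval2_const comm_ring_hom_fps_const)

lemma along_nth_0: "along u v P $ 0 = eval2 id P u"
proof -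
  have "along u v P $ 0 = eval2 (\<lambda>c. fps_const c $ 0) P (\<lambda>i. line u v i $ 0)"
    unfolding along_def
    by (rule eval2_hom_compose[OF comm_ring_hom_fps_nth_0 comm_ring_hom_fps_const])
  then show ?thesis by (simp add: line_def id_def)
qed

lemma along_euler:
  assumes "form2 n P"
  shows "line u v 0 * along u v (pd_s P) + line u v 1 * along u v (pd_t P) = of_nat n * along u v P"
proof -
  interpret comm_ring_hom "along u v" by (rule comm_ring_hom_along)
  show ?thesis
    using arg_cong[OF euler_form2[OF assms], of "along u v"]
    by (simp add: hom_add hom_mult hom_of_nat along_vars)
qed

lemma fps_deriv_along:
  "form2 n P \<Longrightarrow> fps_deriv (along u v P) =
     fps_const (v 0) * along u v (pd_s P) + fps_const (v 1) * along u v (pd_t P)"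
proof (induction rule: form2_induct)
  case (const c)
  interpret comm_ring_hom "along u v" by (rule comm_ring_hom_along)
  show ?case by (simp add: pd_const along_const)
next
  case (step n B)
  interpret comm_ring_hom "along u v" by (rule comm_ring_hom_along)
  have "fps_deriv (line u v i) = fps_const (v i)" for i
    by (simp add: line_def)
  then show ?case
    unfolding pd_s_lincomb pd_t_lincomb
    by (simp add: hom_add hom_mult hom_sum sum_lessThan_2 along_vars step.IH del: mult_pCons_left One_nat_def)
      (simp add: algebra_simps)
qed

text \<open>Since \<open>u\<close> and \<open>v\<close> are independent, no binary form is lost
  under restriction. Induction on the degree shows that both partial derivatives vanish, and Euler's
  formula then gives the form itself.\<close>

lemma along_form_eq_0:
  assumes D: "u 0 * v 1 - u 1 * v 0 \<noteq> 0"
  shows "form2 n P \<Longrightarrow> along u v P = 0 \<Longrightarrow> P = 0"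
proof (induction n arbitrary: P)
  case 0
  then show ?case by (metis along_const fps_const_eq_0_iff form2_0E pCons_0_0)
next
  case (Suc n)
  define S T where "S = along u v (pd_s P)" and "T = along u v (pd_t P)"
  have 1: "fps_const (v 0) * S + fps_const (v 1) * T = 0"
    using fps_deriv_along[OF Suc.prems(1), of u v] Suc.prems(2) by (simp add: S_def T_def)
  have 2: "line u v 0 * S + line u v 1 * T = 0"
    using along_euler[OF Suc.prems(1), of u v] Suc.prems(2) by (simp add: S_def T_def)
  \<comment> \<open>Cramer's rule for the two relations: the powers of \<open>fps_X\<close> cancel,
    and the determinant is constant up to sign.\<close>
  have "fps_const (u 0 * v 1 - u 1 * v 0) * S
      = fps_const (v 1) * (line u v 0 * S + line u v 1 * T) - line u v 1 * (fps_const (v 0) * S + fps_const (v 1) * T)"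
    unfolding line_def fps_const_sub[symmetric] fps_const_mult[symmetric] by (simp only: algebra_simps)
  then have "S = 0" using D by (simp only: 1 2) simp
  have "fps_const (u 0 * v 1 - u 1 * v 0) * T
      = line u v 0 * (fps_const (v 0) * S + fps_const (v 1) * T) - fps_const (v 0) * (line u v 0 * S + line u v 1 * T)"
    unfolding line_def fps_const_sub[symmetric] fps_const_mult[symmetric] by (simp only: algebra_simps)
  then have "T = 0" using D by (simp only: 1 2) simp
  have "pd_s P = 0" "pd_t P = 0"
    using Suc.IH \<open>S = 0\<close> \<open>T = 0\<close> Suc.prems(1) by (auto simp: S_def T_def form2_pd_s form2_pd_t)
  then have "of_nat (Suc n) * P = 0"
    using euler_form2[OF Suc.prems(1)] by simp
  then show ?case by (simp del: of_nat_Suc)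
qed

text \<open>By induction both first partial derivatives restrict to order \<open>k\<close>, one more
  than the index of the hypothesis. The chain rule carries this to the derivative of the
  restriction, Euler's formula to the restriction itself.\<close>

lemma along_order:
  assumes "form2 n P" "k \<le> n"
    and "\<And>i. i \<le> k \<Longrightarrow> eval2 id ((pd_s ^^ (k - i)) ((pd_t ^^ i) P)) u = 0"
  shows "fps_X ^ Suc k dvd along u v P"
  using assms
proof (induction k arbitrary: n P)
  case 0
  then have "along u v P $ 0 = 0" using along_nth_0[of u v P] 0(3)[of 0] by (simp add: id_def)
  then show ?case using fps_X_power_dvd_iff[of 1 "along u v P"] by simp
next
  case (Suc k)
  then obtain m where n: "n = Suc m" by (cases n) auto
  have "fps_X ^ Suc k dvd along u v (pd_s P)"
  proof (rule Suc.IH)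
    show "form2 m (pd_s P)" using Suc.prems(1) n form2_pd_s by blast
    show "k \<le> m" using Suc.prems n by simp
    show "eval2 id ((pd_s ^^ (k - i)) ((pd_t ^^ i) (pd_s P))) u = 0" if "i \<le> k" for i
      using Suc.prems(3)[of i] that
      by (simp add: pd_t_power_commute Suc_diff_le funpow_swap1 id_def)
  qed
  moreover have "fps_X ^ Suc k dvd along u v (pd_t P)"
  proof (rule Suc.IH)
    show "form2 m (pd_t P)" using Suc.prems(1) n form2_pd_t by blast
    show "k \<le> m" using Suc.prems n by simp
    show "eval2 id ((pd_s ^^ (k - i)) ((pd_t ^^ i) (pd_t P))) u = 0" if "i \<le> k" for i
      using Suc.prems(3)[of "Suc i"] that by (simp add: funpow_swap1 id_def)
  qed
  ultimately have deriv: "fps_X ^ Suc k dvd fps_deriv (along u v P)"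
    and euler: "fps_X ^ Suc k dvd of_nat n * along u v P"
    unfolding fps_deriv_along[OF Suc.prems(1)] along_euler[OF Suc.prems(1), symmetric, of u v]
    by (auto intro!: dvd_add dvd_mult simp del: power_Suc)
  \<comment> \<open>Low coefficients vanish by Euler's formula, where \<open>k \<le> n\<close> keeps
    the factor \<open>n\<close> nonzero; the top one, \<open>j = Suc k\<close>, is read off from the
    derivative.\<close>
  have "along u v P $ j = 0" if "j < Suc (Suc k)" for j
  proof (cases "j < Suc k")
    case True
    have "(of_nat n * along u v P) $ j = 0"
      using euler True by (simp add: fps_X_power_dvd_iff del: power_Suc)
    then show ?thesis by (simp add: n fps_of_nat[symmetric] del: of_nat_Suc)
  next
    case False
    then have "j = Suc k" using that by simp
    moreover have "fps_deriv (along u v P) $ k = 0"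
      using deriv by (simp add: fps_X_power_dvd_iff del: power_Suc)
    ultimately show ?thesis by (simp del: of_nat_Suc)
  qed
  then show ?case
    by (simp add: fps_X_power_dvd_iff del: power_Suc)
qed

subsection \<open>The local ring at a smooth point of a parametrized curve\<close>

locale parametrized_point =
  fixes d :: nat and F :: tripoly and \<phi> :: "nat \<Rightarrow> bipoly" and u v p :: "nat \<Rightarrow> complex"
  assumes d_pos: "d > 0" and form_F: "form3 d F"
    and form_\<phi>: "\<And>i. i < 3 \<Longrightarrow> form2 d (\<phi> i)"
    and F_\<phi>: "eval3 const2 F \<phi> = 0"
    and uv: "u 0 * v 1 - u 1 * v 0 \<noteq> 0"
    and p: "\<And>i. i < 3 \<Longrightarrow> p i = eval2 id (\<phi> i) u"
    and smooth: "smooth_point F p"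
begin

definition pull :: "tripoly \<Rightarrow> complex fps" where
  "pull A = eval3 fps_const A (\<lambda>i. along u v (\<phi> i))"

sublocale pull: comm_ring_hom pull
  unfolding pull_def by (intro comm_ring_hom_eval3 comm_ring_hom_fps_const)

sublocale at: comm_ring_hom "\<lambda>A. eval3 id A p"
  by (intro comm_ring_hom_eval3 comm_ring_hom_id)

sublocale k: comm_ring_hom const3
  by (rule comm_ring_hom_const3)

lemma pull_along: "pull A = along u v (eval3 const2 A \<phi>)"
  unfolding pull_def eval3_hom_compose[OF comm_ring_hom_along comm_ring_hom_const2] along_const ..

lemma pull_const: "pull (const3 c) = fps_const c"
  by (simp add: pull_def eval3_const comm_ring_hom_fps_const)

lemma pull_F: "pull F = 0"
proof -
  interpret comm_ring_hom "along u v" by (rule comm_ring_hom_along)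
  show ?thesis by (simp add: pull_along F_\<phi>)
qed

lemma pull_nth_0: "pull A $ 0 = eval3 id A p"
proof -
  have const: "(\<lambda>c. fps_const c $ 0) = (id :: complex \<Rightarrow> complex)"
    by (simp add: fun_eq_iff)
  have "pull A $ 0 = eval3 (\<lambda>c. fps_const c $ 0) A (\<lambda>i. along u v (\<phi> i) $ 0)"
    unfolding pull_def
    by (rule eval3_hom_compose[OF comm_ring_hom_fps_nth_0 comm_ring_hom_fps_const])
  also have "\<dots> = eval3 id A p"
    unfolding along_nth_0 const by (rule eval3_cong) (simp add: p)
  finally show ?thesis .
qed

lemma nonvanishing_nonzero: "eval3 id H p \<noteq> 0 \<Longrightarrow> H \<noteq> 0"
  by auto

text \<open>An element of the fraction field has many homogeneous representations; a choice is made
  here, and the next lemma removes the dependence on it.\<close>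

definition local_ev :: "tripoly fract \<Rightarrow> complex fps" where
  "local_ev b = (SOME y. \<exists>A H n. b = Fract A H \<and> form3 n A \<and> form3 n H \<and> eval3 id H p \<noteq> 0 \<and>
     y = pull A * inverse (pull H))"

text \<open>Equal fractions agree after cross multiplication, \<open>pull\<close> respects products,
  and denominators nonzero at \<open>p\<close> pull back to units.\<close>

lemma local_ev_Fract:
  assumes "form3 n A" "form3 n H" "eval3 id H p \<noteq> 0"
  shows "local_ev (Fract A H) = pull A * inverse (pull H)"
  unfolding local_ev_def
proof (rule someI2)
  show "\<exists>A' H' n. Fract A H = Fract A' H' \<and> form3 n A' \<and> form3 n H' \<and> eval3 id H' p \<noteq> 0 \<and>
      pull A * inverse (pull H) = pull A' * inverse (pull H')"
    using assms by blast
next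
  fix y
  assume "\<exists>A' H' n. Fract A H = Fract A' H' \<and> form3 n A' \<and> form3 n H' \<and> eval3 id H' p \<noteq> 0 \<and>
      y = pull A' * inverse (pull H')"
  then obtain A' H' where *: "Fract A H = Fract A' H'" "eval3 id H' p \<noteq> 0"
    and y: "y = pull A' * inverse (pull H')" by blast
  have nz: "pull H $ 0 \<noteq> 0" "pull H' $ 0 \<noteq> 0"
    using assms(3) *(2) by (simp_all add: pull_nth_0)
  have "A * H' = A' * H"
    using * assms(3) by (simp add: eq_fract nonvanishing_nonzero)
  then have "pull A * pull H' = pull A' * pull H"
    by (metis pull.hom_mult)
  then have "pull A * pull H' * (inverse (pull H) * inverse (pull H'))
      = pull A' * pull H * (inverse (pull H) * inverse (pull H'))" by simp
  moreover have "pull H * inverse (pull H) = 1" "pull H' * inverse (pull H') = 1"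
    using nz by (simp_all add: inverse_mult_eq_1')
  ultimately show "y = pull A * inverse (pull H)"
    unfolding y by (metis (no_types, lifting) mult.assoc mult.commute mult.right_neutral)
qed

lemma local_ringE:
  assumes "b \<in> local_ring p"
  obtains A H n where "b = Fract A H" "form3 n A" "form3 n H" "eval3 id H p \<noteq> 0"
    "local_ev b = pull A * inverse (pull H)"
  using assms local_ev_Fract unfolding local_ring_def by blast

lemma local_ringI: "form3 n A \<Longrightarrow> form3 n H \<Longrightarrow> eval3 id H p \<noteq> 0 \<Longrightarrow> Fract A H \<in> local_ring p"
  unfolding local_ring_def by blast

end

text \<open>The linear forms given by \<open>c0\<close> and \<open>c1\<close>, together with
  \<open>T\<close>, are coordinates dual to \<open>p\<close>, \<open>e1\<close>, \<open>e2\<close>.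
  The first dehomogenizes, and \<open>e1\<close> is a tangent direction on which \<open>c1\<close>
  is 1, so the line of \<open>c1\<close> crosses the curve transversally.\<close>

locale adapted_point = parametrized_point +
  fixes c0 c1 e1 e2 :: "nat \<Rightarrow> complex" and T :: tripoly
  assumes T: "T = tangent_line F p"
    and c_p: "eval3 id (lin3 c0) p = 1" and l_p: "eval3 id (lin3 c1) p = 0"
    and vars: "\<And>i. i < 3 \<Longrightarrow> vars3 i = const3 (p i) * lin3 c0 + const3 (e1 i) * lin3 c1 + const3 (e2 i) * T"
    and l_a: "(\<Sum>i<3. c1 i * e1 i) = 1" and T_a: "(\<Sum>i<3. eval3 id (pd3 i F) p * e1 i) = 0"
begin

abbreviation "l0 \<equiv> lin3 c0"
abbreviation "l1 \<equiv> lin3 c1"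

lemma T_lin3: "T = lin3 (\<lambda>i. eval3 id (pd3 i F) p)"
  by (simp only: T tangent_line_def lin3_def)

lemma form_l0: "form3 1 l0" and form_l1: "form3 1 l1" and form_T: "form3 1 T"
  unfolding T_lin3 by (rule form3_lin3)+

lemma F_p: "eval3 id F p = 0"
  using smooth by (simp add: smooth_point_def)

lemma T_p: "eval3 id T p = 0"
  unfolding T_lin3 eval3_lin3[OF comm_ring_hom_id]
  using euler_form3_at[OF form_F, of p] F_p by (simp add: mult.commute)

lemma expand:
  assumes "form3 (Suc n) A"
  obtains B C where "form3 n B" "form3 n C" "A = const3 (eval3 id A p) * l0 ^ Suc n + l1 * B + T * C"
  using form3_expand[OF form_l0 form_l1 form_T c_p l_p T_p vars assms] by blast

lemma pd3_lin3: "i < 3 \<Longrightarrow> pd3 i (lin3 e) = const3 (e i)"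
proof -
  assume i: "i < 3"
  have "pd3 i (lin3 e) = (\<Sum>j<3. if j = i then const3 (e j) else 0)"
    unfolding lin3_def derivation_sum[OF derivation_pd3[OF i]] derivation_mult[OF derivation_pd3[OF i]]
    using i by (intro sum.cong) (simp_all add: pd3_const pd3_vars)
  with i show ?thesis by simp
qed

text \<open>The gradients at \<open>p\<close> of \<open>F\<close> and of
  \<open>l1 * K + T * H\<close> are compared. Smoothness makes \<open>T\<close> nonzero and appears
  as \<open>H\<close> being a unit at \<open>p\<close>, so that \<open>T\<close> can be eliminated
  modulo \<open>F\<close>.\<close>

lemma F_split:
  obtains K H where "form3 (d - 1) K" "form3 (d - 1) H" "F = l1 * K + T * H"
    "eval3 id K p = 0" "eval3 id H p = 1"
proof -
  obtain n where n: "d = Suc n" using d_pos by (cases d) auto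
  obtain K H where KH: "form3 n K" "form3 n H" "F = l1 * K + T * H"
    using expand[of n F] form_F F_p n by auto
  define t where "t i = eval3 id (pd3 i F) p" for i
  have grad: "t i = c1 i * eval3 id K p + t i * eval3 id H p" if "i < 3" for i
  proof -
    have "pd3 i F = const3 (c1 i) * K + l1 * pd3 i K + (const3 (t i) * H + T * pd3 i H)"
      by (subst KH(3)) (simp only: derivation_add[OF derivation_pd3[OF that]]
        derivation_mult[OF derivation_pd3[OF that]] pd3_lin3[OF that] T_lin3 t_def)
    from arg_cong[OF this, of "\<lambda>A. eval3 id A p"] show ?thesis
      unfolding at.hom_add at.hom_mult l_p T_p eval3_const[OF comm_ring_hom_id] t_def[symmetric] by simp
  qed
  \<comment> \<open>Pairing with the tangent direction kills the gradient and isolates the value of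
    \<open>K\<close>.\<close>
  have "(\<Sum>i<3. t i * e1 i) = (\<Sum>i<3. c1 i * e1 i) * eval3 id K p + (\<Sum>i<3. t i * e1 i) * eval3 id H p"
    unfolding sum_distrib_right sum.distrib[symmetric]
    by (rule sum.cong[OF refl]) (subst grad, simp, simp add: algebra_simps)
  then have K: "eval3 id K p = 0"
    using l_a T_a by (simp add: t_def)
  moreover obtain i where "i < 3" "t i \<noteq> 0"
    using smooth by (auto simp: smooth_point_def t_def)
  then have "eval3 id H p = 1" using grad[of i] K by simp
  ultimately show ?thesis using KH n that by simp
qed

definition x :: "tripoly fract" where "x = Fract l1 l0"
definition f :: "tripoly fract" where "f = Fract F (l0 ^ d)"

lemma form_l0_power: "form3 n (l0 ^ n)"
  using form3_power[OF form_l0, of n] by simp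

lemma l0_power_p: "eval3 id (l0 ^ n) p = 1"
  by (simp add: at.hom_power c_p)

text \<open>The essential obligation is that \<open>x\<close> generates the maximal ideal modulo
  \<open>f\<close>; the others are arithmetic of homogeneous fractions.\<close>

sublocale local_branch "local_ring p" "\<lambda>c. Fract (const3 c) 1" local_ev x f
proof
  note Fract_ev = local_ev_Fract
  have one: "form3 0 1" "eval3 id 1 p \<noteq> 0" "pull 1 = 1"
    using form3_const[of 1] by (simp_all flip: one_pCons)
  have unit: "pull H * inverse (pull H) = 1" if "eval3 id H p \<noteq> 0" for H
    using that by (simp add: inverse_mult_eq_1' pull_nth_0)
  {
    fix y z assume "y \<in> local_ring p" "z \<in> local_ring p"
    then obtain A H n B G m where
      y: "y = Fract A H" "form3 n A" "form3 n H" "eval3 id H p \<noteq> 0" "local_ev y = pull A * inverse (pull H)" and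
      z: "z = Fract B G" "form3 m B" "form3 m G" "eval3 id G p \<noteq> 0" "local_ev z = pull B * inverse (pull G)"
      by (metis local_ringE)
    have HG: "form3 (n + m) (H * G)" "eval3 id (H * G) p \<noteq> 0"
      using y z by (simp_all add: form3_mult at.hom_mult)
    have AG: "form3 (n + m) (A * G + B * H)" "form3 (n + m) (A * B)"
      using form3_add[OF form3_mult[OF y(2) z(3)], of "B * H"] form3_mult[OF z(2) y(3)]
        form3_mult[OF y(2) z(2)] by (simp_all add: add.commute)
    have sum: "y + z = Fract (A * G + B * H) (H * G)" and prod: "y * z = Fract (A * B) (H * G)"
      using y z by (simp_all add: nonvanishing_nonzero)
    show "y + z \<in> local_ring p" "y * z \<in> local_ring p"
      unfolding sum prod using HG AG by (auto intro: local_ringI)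
    have inv: "inverse (pull (H * G)) = inverse (pull H) * inverse (pull G)"
      by (simp add: pull.hom_mult fps_inverse_mult)
    show "local_ev (y * z) = local_ev y * local_ev z"
      unfolding prod Fract_ev[OF AG(2) HG] y(5) z(5) inv by (simp add: pull.hom_mult mult_ac)
    have "local_ev (y + z) = pull A * inverse (pull H) * (pull G * inverse (pull G))
        + pull B * inverse (pull G) * (pull H * inverse (pull H))"
      unfolding sum Fract_ev[OF AG(1) HG] inv by (simp add: pull.hom_mult pull.hom_add algebra_simps)
    then show "local_ev (y + z) = local_ev y + local_ev z"
      by (simp only: unit[OF y(4)] unit[OF z(4)] y(5) z(5) mult_1_right)
  }
  fix e :: complex
  show "Fract (const3 e) 1 \<in> local_ring p"
    using one form3_const by (intro local_ringI)
  show "local_ev (Fract (const3 e) 1) = fps_const e"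
    using Fract_ev[OF form3_const one(1,2)] one(3) by (simp add: pull_const)
  show "Fract (const3 0) 1 = 0" by (simp add: Zero_fract_def)
  show "Fract (const3 1) 1 = 1" by (simp add: One_fract_def flip: one_pCons)
  fix e' :: complex
  show "Fract (const3 (e + e')) 1 = Fract (const3 e) 1 + Fract (const3 e') 1" by simp
  show "Fract (const3 (e * e')) 1 = Fract (const3 e) 1 * Fract (const3 e') 1"
    by (simp add: mult.commute)
next
  note Fract_ev = local_ev_Fract
  have l0: "eval3 id l0 p \<noteq> 0" using c_p by simp
  show "x \<in> local_ring p" unfolding x_def using form_l0 form_l1 l0 by (intro local_ringI)
  show "f \<in> local_ring p" unfolding f_def using form_F form_l0_power
    by (rule local_ringI) (simp add: l0_power_p)
  show "local_ev x $ 0 = 0"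
    unfolding x_def Fract_ev[OF form_l1 form_l0 l0] by (simp add: pull_nth_0 l_p)
  show "local_ev f = 0"
    unfolding f_def by (subst Fract_ev[OF form_F form_l0_power]) (simp_all add: l0_power_p pull_F)
next
  fix y assume "y \<in> local_ring p"
  then obtain A H n where y: "y = Fract A H" "form3 n A" "form3 n H" "eval3 id H p \<noteq> 0"
    "local_ev y = pull A * inverse (pull H)"
    by (metis local_ringE)
  have ev0: "local_ev y $ 0 = eval3 id A p * inverse (eval3 id H p)"
    unfolding y(5) by (simp add: pull_nth_0)
  show "inverse y \<in> local_ring p" if "local_ev y $ 0 \<noteq> 0"
    using that ev0 y by (auto intro!: local_ringI)
  show "\<exists>g\<in>local_ring p. \<exists>h\<in>local_ring p. y = x * g + f * h" if "local_ev y $ 0 = 0"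
  proof -
    have A: "eval3 id A p = 0" using that ev0 y(4) by simp
    obtain K G where KG: "form3 (d - 1) K" "form3 (d - 1) G" "F = l1 * K + T * G" "eval3 id G p = 1"
      using F_split by metis
    show ?thesis
    proof (cases n)
      case 0
      then have "A = 0" using y(2) A eval3_form_const[of A p] by simp
      then have "y = 0"
        using y by (simp add: Zero_fract_def eq_fract nonvanishing_nonzero)
      moreover have "form3 0 1" using form3_const[of 1] by (simp flip: one_pCons)
      then have "0 \<in> local_ring p"
        using local_ringI[OF form3_0] unfolding Zero_fract_def by simp
      ultimately show ?thesis by (intro bexI[of _ 0]) simp_all
    next
      case (Suc m)
      obtain B C where BC: "form3 m B" "form3 m C" "A = l1 * B + T * C"
        using expand[of m A] y(2) A Suc by auto
      \<comment> \<open>Multiplying \<open>A\<close> by the unit \<open>G\<close> turns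
        \<open>T * G\<close> into \<open>F - l1 * K\<close>, which leaves a multiple of
        \<open>l1\<close> modulo \<open>F\<close>.\<close>
      define D where "D = G * B - K * C"
      have D: "form3 (d - 1 + m) D"
        unfolding D_def by (intro form3_diff form3_mult KG BC)
      have GA: "G * A = l1 * D + F * C"
        by (simp only: BC(3) KG(3) D_def algebra_simps)
      have GH: "form3 (Suc (d - 1 + m)) (G * H)" "eval3 id (G * H) p \<noteq> 0"
        using form3_mult[OF KG(2) y(3)] KG(4) y(4) Suc by (simp_all add: at.hom_mult)
      have nz: "H \<noteq> 0" "G \<noteq> 0" "l0 \<noteq> 0"
        using y(4) KG(4) c_p by (auto intro!: nonvanishing_nonzero)
      have 1: "Fract (D * l0) (G * H) \<in> local_ring p"
        using form3_mult[OF D form_l0] GH by (intro local_ringI) auto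
      have 2: "Fract (C * l0 ^ d) (G * H) \<in> local_ring p"
        using form3_mult[OF BC(2) form_l0_power[of d]] GH d_pos
        by (intro local_ringI[of "Suc (d - 1 + m)"]) (auto simp: add.commute)
      have "x * Fract (D * l0) (G * H) + f * Fract (C * l0 ^ d) (G * H)
          = Fract (l1 * D) (G * H) + Fract (F * C) (G * H)"
        using nz by (simp add: x_def f_def eq_fract algebra_simps)
      also have "\<dots> = Fract (l1 * D + F * C) (G * H)"
        using nz by (simp add: eq_fract algebra_simps)
      also have "\<dots> = y"
        using nz y(1) by (simp add: GA[symmetric] eq_fract)
      finally show ?thesis using 1 2 by metis
    qed
  qed
qed

end

subsection \<open>Intersection multiplicity as order of vanishing\<close>

locale birational_point = adapted_point +
  fixes \<psi> :: "nat \<Rightarrow> tripoly" and e :: nat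
  assumes form_\<psi>: "\<And>i. i < 2 \<Longrightarrow> form3 e (\<psi> i)"
    and \<psi>_nonzero: "\<exists>i<2. eval3 const2 (\<psi> i) \<phi> \<noteq> 0"
    and \<psi>_inverse: "eval3 const2 (\<psi> 0) \<phi> * vars2 1 = eval3 const2 (\<psi> 1) \<phi> * vars2 0"
begin

text \<open>The rational inverse recovers the parameter of the line from points of the curve, so a
  ratio of pullbacks equals \<open>fps_X\<close>. Two consecutive orders thus occur.\<close>

lemma x_order: "local_ev x $ 1 \<noteq> 0"
proof -
  define y where "y i = pull (\<psi> i)" for i
  interpret along: comm_ring_hom "along u v" by (rule comm_ring_hom_along)
  have inv: "y 0 * line u v 1 = y 1 * line u v 0"
    using arg_cong[OF \<psi>_inverse, of "along u v"]
    by (simp add: y_def pull_along along.hom_mult along_vars)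
  have nz: "\<exists>i<2. y i \<noteq> 0"
  proof -
    obtain i where i: "i < 2" "eval3 const2 (\<psi> i) \<phi> \<noteq> 0" using \<psi>_nonzero by blast
    have "form2 (e * d) (eval3 const2 (\<psi> i) \<phi>)"
      using form_\<psi>[OF i(1)] form_\<phi> by (rule form2_eval3)
    from along_form_eq_0[OF uv this] i show ?thesis
      unfolding y_def pull_along by blast
  qed
  \<comment> \<open>The pair \<open>y\<close> is proportional to \<open>u + X v\<close>; these
    combinations extract its components along \<open>u\<close> and \<open>v\<close>, up to one
    common factor.\<close>
  define z z' where "z = fps_const (v 1) * y 0 - fps_const (v 0) * y 1"
    and "z' = fps_const (u 0) * y 1 - fps_const (u 1) * y 0"
  have z': "z' = fps_X * z"
    using inv by (simp add: z_def z'_def line_def algebra_simps)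
  \<comment> \<open>Inverting the change of basis shows that \<open>z = 0\<close> would force both
    \<open>y 0\<close> and \<open>y 1\<close> to vanish.\<close>
  have "fps_const (u 0 * v 1 - u 1 * v 0) * y 0 = fps_const (u 0) * z + fps_const (v 0) * z'"
    "fps_const (u 0 * v 1 - u 1 * v 0) * y 1 = fps_const (u 1) * z + fps_const (v 1) * z'"
    unfolding z_def z'_def fps_const_sub[symmetric] fps_const_mult[symmetric]
    by (simp_all only: algebra_simps)
  then have "z \<noteq> 0"
    using nz uv by (auto simp: z' dest!: less_2_cases_nat)
  define B B' where "B = const3 (v 1) * \<psi> 0 - const3 (v 0) * \<psi> 1"
    and "B' = const3 (u 0) * \<psi> 1 - const3 (u 1) * \<psi> 0"
  have form: "form3 e B" "form3 e B'"
    unfolding B_def B'_def by (auto intro!: form3_diff form3_const_mult form_\<psi> simp del: mult_pCons_left)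
  have pull: "pull B = z" "pull B' = z'"
    unfolding B_def B'_def z_def z'_def y_def by (simp_all only: pull.hom_minus pull.hom_mult pull_const)
  have l0e: "eval3 id (l0 ^ e) p \<noteq> 0" by (simp add: l0_power_p)
  note ev = local_ev_Fract[OF _ form_l0_power l0e]
  have "pull (l0 ^ e) $ 0 \<noteq> 0" using l0e by (simp add: pull_nth_0)
  then have "inverse (pull (l0 ^ e)) \<noteq> 0"
    by (metis fps_inverse_eq_0_iff)
  then show ?thesis
    using \<open>z \<noteq> 0\<close>
    by (intro ev_x_order_1[OF local_ringI[OF form(1) form_l0_power l0e] local_ringI[OF form(2) form_l0_power l0e]])
      (simp_all add: ev form pull z' mult.assoc)
qed

sublocale local_smooth_branch "local_ring p" "\<lambda>c. Fract (const3 c) 1" local_ev x f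
  by unfold_locales (rule x_order)

section \<open>From the local ideal to orders of pullbacks\<close>

lemma local_ideal_ev:
  assumes "fps_X ^ n dvd pull G" "b \<in> local_ideal p G F"
  shows "fps_X ^ n dvd local_ev b"
proof -
  obtain A B H m where b: "b = Fract (A * G + B * F) H" "form3 m (A * G)" "form3 m (B * F)" "form3 m H"
    "eval3 id H p \<noteq> 0"
    using assms(2) unfolding local_ideal_def by blast
  have "local_ev b = pull A * pull G * inverse (pull H)"
    unfolding b(1) local_ev_Fract[OF form3_add[OF b(2,3)] b(4,5)]
    by (simp add: pull.hom_add pull.hom_mult pull_F)
  then show ?thesis using assms(1) by simp
qed

text \<open>Over a common denominator, the powers of \<open>l0\<close> bring both numerators to the
  same degree \<open>N\<close>, as homogeneity in \<open>local_ideal\<close> demands.\<close>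

lemma local_ideal_mem:
  assumes G: "form3 g G" and "h \<in> local_ring p" "h' \<in> local_ring p"
  shows "Fract G (l0 ^ g) * h + f * h' \<in> local_ideal p G F"
proof -
  obtain A H n where h: "h = Fract A H" "form3 n A" "form3 n H" "eval3 id H p \<noteq> 0"
    using assms(2) by (metis local_ringE)
  obtain A' H' m where h': "h' = Fract A' H'" "form3 m A'" "form3 m H'" "eval3 id H' p \<noteq> 0"
    using assms(3) by (metis local_ringE)
  define N where "N = n + m + d + g"
  have "form3 N (A * (l0 ^ d * H') * G)" "form3 N (A' * (l0 ^ g * H) * F)" "form3 N (l0 ^ g * H * (l0 ^ d * H'))"
    using form3_mult[OF form3_mult[OF h(2) form3_mult[OF form_l0_power[of d] h'(3)]] G]
      form3_mult[OF form3_mult[OF h'(2) form3_mult[OF form_l0_power[of g] h(3)]] form_F]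
      form3_mult[OF form3_mult[OF form_l0_power[of g] h(3)] form3_mult[OF form_l0_power[of d] h'(3)]]
    by (simp_all add: N_def add_ac)
  moreover have "eval3 id (l0 ^ g * H * (l0 ^ d * H')) p \<noteq> 0"
    using h h' by (simp add: at.hom_mult l0_power_p)
  moreover have "Fract G (l0 ^ g) * h + f * h'
      = Fract (A * (l0 ^ d * H') * G + A' * (l0 ^ g * H) * F) (l0 ^ g * H * (l0 ^ d * H'))"
  proof -
    have "l0 \<noteq> 0" "H \<noteq> 0" "H' \<noteq> 0"
      using h h' c_p by (auto intro!: nonvanishing_nonzero)
    then show ?thesis
      by (simp add: h h' f_def eq_fract algebra_simps)
  qed
  ultimately show ?thesis unfolding local_ideal_def by blast
qed

lemma intersection_mult_ge:
  assumes "fps_X ^ n dvd pull G"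
  shows "enat n \<le> intersection_mult p G F"
proof -
  obtain B where "finite B" "B \<subseteq> local_ring p" "card B = n"
    "\<forall>c. (\<Sum>b\<in>B. Fract (const3 (c b)) 1 * b) \<in> local_ideal p G F \<longrightarrow> (\<forall>b\<in>B. c b = 0)"
    using ex_independent[of "local_ideal p G F" n] local_ideal_ev[OF assms] by blast
  then show ?thesis
    unfolding intersection_mult_def by (intro SUP_upper2[of B]) auto
qed

text \<open>Dividing by \<open>l0 ^ g\<close> puts \<open>G\<close> into the local ring without
  changing its order, since \<open>l0\<close> is a unit at \<open>p\<close>. The bound on
  independent residues then applies.\<close>

lemma intersection_mult_le:
  assumes "form3 g G" "pull G \<noteq> 0"
  shows "intersection_mult p G F \<le> enat (subdegree (pull G))"
proof -
  have l0g: "eval3 id (l0 ^ g) p \<noteq> 0" by (simp add: l0_power_p)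
  note ev = local_ev_Fract[OF assms(1) form_l0_power l0g]
  have unit: "pull (l0 ^ g) $ 0 \<noteq> 0" using l0g by (simp add: pull_nth_0)
  then have inv: "inverse (pull (l0 ^ g)) $ 0 \<noteq> 0" by simp
  then have nz: "inverse (pull (l0 ^ g)) \<noteq> 0" by force
  have sub: "subdegree (local_ev (Fract G (l0 ^ g))) = subdegree (pull G)"
    unfolding ev using assms(2) nz inv by simp
  show ?thesis
    unfolding intersection_mult_def
  proof (rule SUP_least, clarify)
    fix B assume B: "finite B" "B \<subseteq> local_ring p"
      "\<forall>c. (\<Sum>b\<in>B. Fract (const3 (c b)) 1 * b) \<in> local_ideal p G F \<longrightarrow> (\<forall>b\<in>B. c b = 0)"
    have "card B \<le> subdegree (local_ev (Fract G (l0 ^ g)))"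
    proof (rule card_independent_le[OF _ _ B(1,2), where J = "local_ideal p G F"])
      show "Fract G (l0 ^ g) \<in> local_ring p" using assms(1) form_l0_power l0g by (rule local_ringI)
      show "local_ev (Fract G (l0 ^ g)) \<noteq> 0" unfolding ev using assms(2) nz by simp
      show "\<forall>b\<in>B. c b = 0" if "(\<Sum>b\<in>B. Fract (const3 (c b)) 1 * b) \<in> local_ideal p G F" for c
        using B(3) that by blast
    qed (use local_ideal_mem[OF assms(1)] in auto)
    then show "enat (card B) \<le> enat (subdegree (pull G))" by (simp add: sub)
  qed
qed

lemma order_of_mult:
  assumes "form3 g G" "enat n \<le> intersection_mult p G F"
  shows "fps_X ^ n dvd pull G"
proof (cases "pull G = 0")
  case False
  have "n \<le> subdegree (pull G)"
    using order.trans[OF assms(2) intersection_mult_le[OF assms(1) False]] by simp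
  then show ?thesis by (auto simp: fps_X_power_dvd_iff intro: nth_less_subdegree_zero)
qed simp

lemma pull_l0: "pull l0 $ 0 = 1"
  by (simp add: pull_nth_0 c_p)

lemma pull_l1: "pull l1 $ 0 = 0" "pull l1 $ 1 \<noteq> 0"
proof -
  show 0: "pull l1 $ 0 = 0" by (simp add: pull_nth_0 l_p)
  have "local_ev x = pull l1 * inverse (pull l0)"
    unfolding x_def by (rule local_ev_Fract[OF form_l1 form_l0]) (simp add: c_p)
  then have "local_ev x $ 1 = pull l1 $ 1 * inverse (pull l0) $ 0"
    by (simp add: fps_mult_nth_1 0)
  then show "pull l1 $ 1 \<noteq> 0" using x_order by auto
qed

text \<open>On the curve \<open>T * H = - l1 * K\<close>, where \<open>H\<close> is a unit at
  \<open>p\<close> and both factors on the right vanish there.\<close>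

lemma pull_T: "fps_X ^ 2 dvd pull T"
proof -
  obtain K H where KH: "F = l1 * K + T * H" "eval3 id K p = 0" "eval3 id H p = 1"
    using F_split by metis
  have "0 = pull l1 * pull K + pull T * pull H"
    using pull_F by (simp only: KH(1) pull.hom_add pull.hom_mult)
  then have "pull T * pull H = - pull l1 * pull K"
    by (simp add: eq_neg_iff_add_eq_0 add.commute)
  moreover have "pull H * inverse (pull H) = 1"
    using KH(3) by (simp add: inverse_mult_eq_1' pull_nth_0)
  ultimately have "pull T = - (pull l1 * pull K) * inverse (pull H)"
    by (metis mult.assoc mult.right_neutral mult_minus_left)
  moreover have "fps_X ^ 1 dvd pull l1" "fps_X ^ 1 dvd pull K"
    unfolding fps_X_power_dvd_iff using pull_l1 KH(2) by (simp_all add: pull_nth_0)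
  then have "fps_X ^ 2 dvd pull l1 * pull K"
    by (simp add: power2_eq_square mult_dvd_mono)
  ultimately show ?thesis by simp
qed

end

subsection \<open>Conics of contact order at least 5\<close>

text \<open>Applied repeatedly to a series in Horner form, this reads off the vanishing of the
  coefficients one by one.\<close>

lemma fps_X_power_dvd_peel:
  fixes P :: "'a::field fps"
  assumes "fps_X ^ Suc n dvd fps_const b * P + fps_X * R" "P $ 0 \<noteq> 0"
  shows "b = 0" "fps_X ^ n dvd R"
proof -
  have *: "(fps_const b * P + fps_X * R) $ k = 0" if "k < Suc n" for k
    using assms(1) that unfolding fps_X_power_dvd_iff by blast
  from *[of 0] show b: "b = 0" using assms(2) by simp
  show "fps_X ^ n dvd R"
    unfolding fps_X_power_dvd_iff using *[of "Suc _"] b by simp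
qed

lemma fps_X_power_dvdE:
  assumes "fps_X ^ n dvd g"
  obtains h where "g = fps_X ^ n * h" "h $ 0 = g $ n"
  using assms by (auto simp: fps_X_power_mult_nth elim!: dvdE)

context birational_point
begin

definition conic :: "(nat \<Rightarrow> complex) \<Rightarrow> tripoly" where
  "conic b = const3 (b 0) * l0\<^sup>2 + const3 (b 1) * (l0 * l1) + const3 (b 2) * l1\<^sup>2 +
     const3 (b 3) * (l0 * T) + const3 (b 4) * (l1 * T) + const3 (b 5) * T\<^sup>2"

lemma conicE:
  assumes "form3 2 Q"
  obtains b where "Q = conic b"
proof -
  obtain B C where BC: "form3 1 B" "form3 1 C" "Q = const3 (eval3 id Q p) * l0 ^ 2 + l1 * B + T * C"
    using expand[of 1 Q] assms by (auto simp: numeral_2_eq_2)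
  have linear: "\<exists>r s t. A = const3 r * l0 + const3 s * l1 + const3 t * T" if "form3 1 A" for A
  proof -
    obtain D E where "form3 0 D" "form3 0 E" "A = const3 (eval3 id A p) * l0 ^ 1 + l1 * D + T * E"
      using expand[of 0 A] \<open>form3 1 A\<close> by auto
    then show ?thesis by (metis eval3_form_const mult.commute power_one_right)
  qed
  obtain r s t where B: "B = const3 r * l0 + const3 s * l1 + const3 t * T" using linear[OF BC(1)] by blast
  obtain r' s' t' where C: "C = const3 r' * l0 + const3 s' * l1 + const3 t' * T" using linear[OF BC(2)] by blast
  \<comment> \<open>The product \<open>l1 * T\<close> arises from both \<open>B\<close> and
    \<open>C\<close>, hence the sum \<open>t + s'\<close>.\<close>
  define b where "b i = [eval3 id Q p, r, s, r', t + s', t'] ! i" for i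
  have b: "b 0 = eval3 id Q p" "b 1 = r" "b 2 = s" "b 3 = r'" "b 4 = t + s'" "b 5 = t'"
    by (simp_all add: b_def)
  have "Q = conic b"
    unfolding conic_def b k.hom_add
    by (subst BC(3), unfold B C) (simp only: power2_eq_square algebra_simps)
  then show ?thesis by (rule that)
qed

lemma conic_diff:
  "const3 s * conic b - const3 t * conic b' = conic (\<lambda>i. s * b i - t * b' i)"
  unfolding conic_def k.hom_minus k.hom_mult by (simp only: algebra_simps)

text \<open>With \<open>m = 2\<close> or \<open>m = 3\<close> the contact order of the tangent line, the products of two of
  \<open>l0, l1, T\<close> have orders \<open>0, 1, 2, m, m + 1, 2 m\<close>. For \<open>m = 2\<close> the order 2 occurs twice, so the
  coefficient of \<open>l1\<^sup>2\<close> determines a conic of contact order at least 5; for \<open>m = 3\<close> only the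
  coefficient of \<open>T\<^sup>2\<close> is left.\<close>

lemma conic_determined:
  assumes "\<not> fps_X ^ 4 dvd pull T"
  obtains \<kappa> where "\<And>b. fps_X ^ 5 dvd pull (conic b) \<Longrightarrow> b \<kappa> = 0 \<Longrightarrow> conic b = 0"
proof -
  define l where "l = pull l0"
  have l: "l $ 0 \<noteq> 0" "(l\<^sup>2) $ 0 \<noteq> 0" using pull_l0 by (simp_all add: l_def power2_eq_square)
  have "fps_X ^ 1 dvd pull l1"
    unfolding fps_X_power_dvd_iff using pull_l1 by simp
  then obtain m where m: "pull l1 = fps_X * m" "m $ 0 \<noteq> 0"
    using pull_l1(2) by (metis fps_X_power_dvdE power_one_right)
  note simps = pull.hom_add pull.hom_mult pull.hom_power pull_const l_def[symmetric] m(1)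
  show ?thesis
  proof (cases "pull T $ 2 = 0")
    case False
    then obtain t where t: "pull T = fps_X\<^sup>2 * t" "t $ 0 \<noteq> 0"
      using pull_T by (metis fps_X_power_dvdE)
    show ?thesis
    \<comment> \<open>Without \<open>l1\<^sup>2\<close> the remaining products have the distinct
      orders 0, 1, 2, 3, 4, which gives the Horner form.\<close>
    proof (rule that[of 2])
      fix b assume X5: "fps_X ^ 5 dvd pull (conic b)" and b2: "b 2 = 0"
      have "pull (conic b) = fps_const (b 0) * l\<^sup>2 + fps_X * (fps_const (b 1) * (l * m) + fps_X *
        (fps_const (b 3) * (l * t) + fps_X * (fps_const (b 4) * (m * t) + fps_X * (fps_const (b 5) * t\<^sup>2 + fps_X * 0))))"
        unfolding conic_def b2 by (simp only: simps t(1) fps_const_0_eq_0) (simp add: algebra_simps power2_eq_square)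
      then have e: "fps_X ^ Suc (Suc (Suc (Suc (Suc 0)))) dvd \<dots>"
        using X5 by (simp add: eval_nat_numeral)
      note p1 = fps_X_power_dvd_peel[OF e l(2)]
      note p2 = fps_X_power_dvd_peel[OF p1(2)]
      note p3 = fps_X_power_dvd_peel[OF p2(2)]
      note p4 = fps_X_power_dvd_peel[OF p3(2)]
      note p5 = fps_X_power_dvd_peel[OF p4(2)]
      have "b 0 = 0" "b 1 = 0" "b 3 = 0" "b 4 = 0" "b 5 = 0"
        using p1(1) p2(1) p3(1) p4(1) p5(1) l m t by (simp_all add: power2_eq_square)
      then show "conic b = 0" by (simp add: conic_def b2)
    qed
  next
    case True
    have X3: "fps_X ^ 3 dvd pull T"
      unfolding fps_X_power_dvd_iff
    proof (intro allI impI)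
      fix k :: nat assume "k < 3"
      then have "k < 2 \<or> k = 2" by auto
      then show "pull T $ k = 0" using pull_T True by (auto simp: fps_X_power_dvd_iff)
    qed
    moreover have "pull T $ 3 \<noteq> 0"
    proof
      assume T3: "pull T $ 3 = 0"
      have "fps_X ^ 4 dvd pull T"
        unfolding fps_X_power_dvd_iff
      proof (intro allI impI)
        fix k :: nat assume "k < 4"
        then have "k < 3 \<or> k = 3" by auto
        then show "pull T $ k = 0" using X3 T3 by (auto simp: fps_X_power_dvd_iff)
      qed
      with assms show False ..
    qed
    ultimately obtain t where t: "pull T = fps_X ^ 3 * t" "t $ 0 \<noteq> 0"
      by (metis fps_X_power_dvdE)
    show ?thesis
    \<comment> \<open>Without \<open>T\<^sup>2\<close>, which has order 6, the remaining products
      again have the orders 0 to 4.\<close>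
    proof (rule that[of 5])
      fix b assume X5: "fps_X ^ 5 dvd pull (conic b)" and b5: "b 5 = 0"
      have "pull (conic b) = fps_const (b 0) * l\<^sup>2 + fps_X * (fps_const (b 1) * (l * m) + fps_X *
        (fps_const (b 2) * m\<^sup>2 + fps_X * (fps_const (b 3) * (l * t) + fps_X * (fps_const (b 4) * (m * t) + fps_X * 0))))"
        unfolding conic_def b5 by (simp only: simps t(1) fps_const_0_eq_0) (simp add: algebra_simps eval_nat_numeral)
      then have e: "fps_X ^ Suc (Suc (Suc (Suc (Suc 0)))) dvd \<dots>"
        using X5 by (simp add: eval_nat_numeral)
      note p1 = fps_X_power_dvd_peel[OF e l(2)]
      note p2 = fps_X_power_dvd_peel[OF p1(2)]
      note p3 = fps_X_power_dvd_peel[OF p2(2)]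
      note p4 = fps_X_power_dvd_peel[OF p3(2)]
      note p5 = fps_X_power_dvd_peel[OF p4(2)]
      have "b 0 = 0" "b 1 = 0" "b 2 = 0" "b 3 = 0" "b 4 = 0"
        using p1(1) p2(1) p3(1) p4(1) p5(1) l m t by (simp_all add: power2_eq_square)
      then show "conic b = 0" by (simp add: conic_def b5)
    qed
  qed
qed

text \<open>A suitable multiple of \<open>Q'\<close> cancels the determining coefficient of
  \<open>Q\<close>; the difference still has contact order 5 and so is zero.\<close>

lemma conics_proportional:
  assumes T4: "\<not> fps_X ^ 4 dvd pull T"
    and Q: "form3 2 Q" "fps_X ^ 5 dvd pull Q" and Q': "form3 2 Q'" "fps_X ^ 5 dvd pull Q'" "Q' \<noteq> 0"
  obtains c where "Q = const3 c * Q'"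
proof -
  obtain \<kappa> where \<kappa>: "\<And>b. fps_X ^ 5 dvd pull (conic b) \<Longrightarrow> b \<kappa> = 0 \<Longrightarrow> conic b = 0"
    using conic_determined[OF T4] by blast
  obtain b b' where b: "Q = conic b" and b': "Q' = conic b'"
    using conicE Q(1) Q'(1) by metis
  have nz: "b' \<kappa> \<noteq> 0" using \<kappa>[of b'] Q' b' by auto
  define s where "s = b \<kappa> / b' \<kappa>"
  have "conic (\<lambda>i. 1 * b i - s * b' i) = 0"
  proof (rule \<kappa>)
    show "fps_X ^ 5 dvd pull (conic (\<lambda>i. 1 * b i - s * b' i))"
      unfolding conic_diff[symmetric] b[symmetric] b'[symmetric] pull.hom_minus pull.hom_mult
      using Q(2) Q'(2) by (intro dvd_diff dvd_mult)
    show "1 * b \<kappa> - s * b' \<kappa> = 0" using nz by (simp add: s_def)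
  qed
  then have "Q = const3 s * Q'"
    unfolding conic_diff[symmetric] b[symmetric] b'[symmetric]
    by (metis eq_iff_diff_eq_0 k.hom_one mult_1)
  then show ?thesis by (rule that)
qed

end

subsection \<open>The determinant\<close>

lemma eval_quad:
  assumes "comm_ring_hom h" "j < 6"
  shows "eval3 h (quad vars3 j) y = quad y j"
proof -
  interpret comm_ring_hom "\<lambda>A. eval3 h A y"
    by (intro comm_ring_hom_eval3 assms)
  from assms(2) have "j = 0 \<or> j = 1 \<or> j = 2 \<or> j = 3 \<or> j = 4 \<or> j = 5" by auto
  then show ?thesis
    by (elim disjE) (simp_all add: quad_def hom_mult hom_power eval3_vars assms)
qed

definition conic_of :: "(nat \<Rightarrow> complex) \<Rightarrow> tripoly" where
  "conic_of a = (\<Sum>j<6. quad vars3 j * const3 (a j))"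

lemma eval_conic_of:
  "comm_ring_hom h \<Longrightarrow> eval3 h (conic_of a) y = (\<Sum>j<6. quad y j * h (a j))"
proof -
  assume h: "comm_ring_hom h"
  interpret comm_ring_hom "\<lambda>A. eval3 h A y"
    by (intro comm_ring_hom_eval3 h)
  show ?thesis
    unfolding conic_of_def hom_sum hom_mult by (simp add: eval3_const h eval_quad)
qed

lemma form3_quad: "j < 6 \<Longrightarrow> form3 2 (quad vars3 j)"
proof -
  have "form3 2 (vars3 i * vars3 k)" if "i < 3" "k < 3" for i k
    using form3_vars_mult[OF form3_vars] that by (simp add: numeral_2_eq_2)
  moreover assume "j < 6"
  then have "j = 0 \<or> j = 1 \<or> j = 2 \<or> j = 3 \<or> j = 4 \<or> j = 5" by auto
  ultimately show ?thesis
    by (elim disjE) (simp_all add: quad_def power2_eq_square)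
qed

lemma form3_conic_of: "form3 2 (conic_of a)"
  unfolding conic_of_def
proof (rule form3_sum)
  fix j :: nat assume "j \<in> {..<6}"
  then show "form3 2 (quad vars3 j * const3 (a j))"
    using form3_const_mult[OF form3_quad[of j]] by (simp only: mult.commute lessThan_iff)
qed

lemma sum_lessThan_6: "(\<Sum>i<6. f i) = f 0 + f 1 + f 2 + f 3 + f 4 + f (5::nat)"
  for f :: "nat \<Rightarrow> 'a::comm_monoid_add"
  by (simp add: eval_nat_numeral lessThan_Suc add_ac)

lemma conic_of_diff: "conic_of a - const3 c * conic_of b = conic_of (\<lambda>j. a j - c * b j)"
proof -
  interpret comm_ring_hom const3 by (rule comm_ring_hom_const3)
  show ?thesis
    unfolding conic_of_def sum_distrib_left sum_subtractf[symmetric] hom_minus hom_mult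
    by (intro sum.cong refl) (simp only: algebra_simps)
qed

text \<open>Six points suffice: the coordinate points give the coefficients of the squares, sums of
  two of them the mixed ones.\<close>

lemma conic_of_eq_0:
  assumes "conic_of a = 0" "j < 6"
  shows "a j = 0"
proof -
  interpret comm_ring_hom "\<lambda>A. eval3 id A y" for y :: "nat \<Rightarrow> complex"
    by (intro comm_ring_hom_eval3 comm_ring_hom_id)
  have "(\<Sum>j<6. quad y j * a j) = 0" for y
    using eval_conic_of[OF comm_ring_hom_id, of a y] assms(1) by simp
  then have *: "(y 0)\<^sup>2 * a 0 + (y 1)\<^sup>2 * a 1 + (y 2)\<^sup>2 * a 2 + y 1 * y 2 * a 3 + y 0 * y 2 * a 4 + y 0 * y 1 * a 5 = 0" for y :: "nat \<Rightarrow> complex"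
    by (simp add: sum_lessThan_6 quad_def)
  have *: "x\<^sup>2 * a 0 + y\<^sup>2 * a 1 + z\<^sup>2 * a 2 + y * z * a 3 + x * z * a 4 + x * y * a 5 = 0" for x y z
    using *[of "\<lambda>i. if i = 0 then x else if i = 1 then y else z"] by simp
  have "a 0 = 0" "a 1 = 0" "a 2 = 0"
    using *[of 1 0 0] *[of 0 1 0] *[of 0 0 1] by simp_all
  moreover from this have "a 3 = 0" "a 4 = 0" "a 5 = 0"
    using *[of 0 1 1] *[of 1 0 1] *[of 1 1 0] by simp_all
  moreover have "j = 0 \<or> j = 1 \<or> j = 2 \<or> j = 3 \<or> j = 4 \<or> j = 5" using assms(2) by auto
  ultimately show ?thesis by auto
qed

lemma derivation_power_lincomb:
  assumes "derivation D" "\<And>c. D (const2 c) = 0"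
  shows "(D ^^ n) (\<Sum>j\<in>J. q j * const2 (a j)) = (\<Sum>j\<in>J. (D ^^ n) (q j) * const2 (a j))"
  by (induction n) (simp_all add: derivation_sum[OF assms(1)] derivation_mult[OF assms(1)] assms(2)
      del: mult_pCons_left mult_pCons_right)

section \<open>Cofactors of the first row\<close>

definition row_matrix :: "(nat \<Rightarrow> 'a) \<Rightarrow> (nat \<Rightarrow> nat \<Rightarrow> 'a) \<Rightarrow> 'a mat" where
  "row_matrix w N = mat 6 6 (\<lambda>(r, j). case r of 0 \<Rightarrow> w j | Suc i \<Rightarrow> N i j)"

text \<open>Cofactors of row 0 do not depend on that row, so it is filled with zeros.\<close>

definition minor :: "(nat \<Rightarrow> nat \<Rightarrow> 'a::comm_ring_1) \<Rightarrow> nat \<Rightarrow> 'a" where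
  "minor N j = cofactor (row_matrix (\<lambda>_. 0) N) 0 j"

lemma det_row_matrix: "det (row_matrix w N) = (\<Sum>j<6. w j * minor N j)"
proof -
  have "mat_delete (row_matrix w N) 0 j = mat_delete (row_matrix (\<lambda>_. 0) N) 0 j" for j
    by (rule eq_matI) (simp_all add: mat_delete_def row_matrix_def)
  then have "cofactor (row_matrix w N) 0 j = minor N j" for j
    by (simp add: cofactor_def minor_def)
  then show ?thesis
    using laplace_expansion_row[of "row_matrix w N" 6 0] by (simp add: row_matrix_def)
qed

lemma minor_hom: "comm_ring_hom h \<Longrightarrow> minor (\<lambda>i j. h (N i j)) j = h (minor N j)"
proof -
  assume "comm_ring_hom h"
  then interpret comm_ring_hom h .
  have "mat_delete (row_matrix (\<lambda>_. 0) (\<lambda>i j. h (N i j))) 0 j = map_mat h (mat_delete (row_matrix (\<lambda>_. 0) N) 0 j)"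
    by (rule eq_matI) (simp_all add: mat_delete_def row_matrix_def)
  then show ?thesis
    by (simp add: cofactor_def minor_def hom_mult hom_power hom_uminus)
qed

text \<open>The sum is the expansion of a determinant in which row \<open>i\<close> of
  \<open>N\<close> occurs twice.\<close>

lemma minor_orthogonal: "i < 5 \<Longrightarrow> (\<Sum>j<6. N i j * minor N j) = 0"
  unfolding det_row_matrix[symmetric]
  by (rule det_identical_rows[of _ 6 0 "Suc i"]) (auto simp: row_matrix_def intro: eq_vecI)

lemma row_matrix_kernel:
  fixes N :: "nat \<Rightarrow> nat \<Rightarrow> 'a::idom"
  assumes "det (row_matrix w N) = 0"
  obtains a where "\<exists>j<6. a j \<noteq> 0" "(\<Sum>j<6. w j * a j) = 0" "\<forall>i<5. (\<Sum>j<6. N i j * a j) = 0"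
proof -
  have M: "row_matrix w N \<in> carrier_mat 6 6" by (simp add: row_matrix_def)
  obtain v where v: "v \<in> carrier_vec 6" "v \<noteq> 0\<^sub>v 6" "row_matrix w N *\<^sub>v v = 0\<^sub>v 6"
    using det_0_iff_vec_prod_zero[OF M] assms by blast
  have row: "(\<Sum>j<6. row_matrix w N $$ (r, j) * vec_index v j) = 0" if "r < 6" for r
    using arg_cong[OF v(3), of "\<lambda>y. vec_index y r"] that v(1)
    by (simp add: scalar_prod_def row_matrix_def atLeast0LessThan)
  show ?thesis
  proof
    show "\<exists>j<6. vec_index v j \<noteq> 0" using v(1,2) by (auto simp: vec_eq_iff)
    show "(\<Sum>j<6. w j * vec_index v j) = 0" using row[of 0] by (simp add: row_matrix_def)
    show "\<forall>i<5. (\<Sum>j<6. N i j * vec_index v j) = 0"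
      using row[of "Suc _"] by (simp add: row_matrix_def)
  qed
qed

definition partials :: "(nat \<Rightarrow> bipoly) \<Rightarrow> (nat \<Rightarrow> complex) \<Rightarrow> nat \<Rightarrow> nat \<Rightarrow> complex" where
  "partials \<phi> u i j = eval2 id ((pd_s ^^ (4 - i)) ((pd_t ^^ i) (quad \<phi> j))) u"

text \<open>Expanding along the row of monomials leaves minors with constant entries, and these are
  constants themselves.\<close>

lemma omega_conic_of: "omega \<phi> u = conic_of (minor (partials \<phi> u))"
proof -
  have "omega \<phi> u = det (row_matrix (quad vars3) (\<lambda>i j. const3 (partials \<phi> u i j)))"
    by (simp only: omega_def row_matrix_def partials_def)
  also have "\<dots> = conic_of (minor (partials \<phi> u))"
    by (simp only: det_row_matrix conic_of_def minor_hom[OF comm_ring_hom_const3])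
  finally show ?thesis .
qed

section \<open>Contact order and nonvanishing of the conic of cofactors\<close>

context birational_point
begin

text \<open>Orthogonality to the five rows says that all fourth partial derivatives at
  \<open>u\<close> of the composed form, of degree \<open>2 * d\<close>, vanish.\<close>

lemma pull_conic_of:
  assumes "4 \<le> 2 * d" "\<And>i. i < 5 \<Longrightarrow> (\<Sum>j<6. partials \<phi> u i j * a j) = 0"
  shows "fps_X ^ 5 dvd pull (conic_of a)"
proof -
  interpret e: comm_ring_hom "\<lambda>P. eval2 id P u"
    by (intro comm_ring_hom_eval2 comm_ring_hom_id)
  define g where "g = eval3 const2 (conic_of a) \<phi>"
  have g: "g = (\<Sum>j<6. quad \<phi> j * const2 (a j))"
    by (simp only: g_def eval_conic_of[OF comm_ring_hom_const2])
  have "fps_X ^ Suc 4 dvd along u v g"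
  proof (rule along_order)
    show "form2 (2 * d) g"
      unfolding g_def by (rule form2_eval3[OF form3_conic_of form_\<phi>])
    show "4 \<le> 2 * d" by fact
    fix i :: nat assume "i \<le> 4"
    then show "eval2 id ((pd_s ^^ (4 - i)) ((pd_t ^^ i) g)) u = 0"
      using assms(2)[of i]
      unfolding g derivation_power_lincomb[OF derivation_pd_t pd_const(2)]
        derivation_power_lincomb[OF derivation_pd_s pd_const(1)] e.hom_sum e.hom_mult
        eval2_const[OF comm_ring_hom_id] partials_def by simp
  qed
  then show ?thesis by (simp add: pull_along g_def)
qed

text \<open>If all minors vanished, the matrix would be singular for every first row. This gives two
  independent coefficient vectors orthogonal to the five rows, although such conics are
  proportional.\<close>

lemma omega_nonzero:
  assumes "4 \<le> 2 * d" and T4: "\<not> fps_X ^ 4 dvd pull T"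
  shows "omega \<phi> u \<noteq> 0"
proof
  define N where "N = partials \<phi> u"
  assume "omega \<phi> u = 0"
  then have minor: "minor N j = 0" if "j < 6" for j
    using conic_of_eq_0[of "minor N" j] that unfolding omega_conic_of N_def by blast
  then have det: "det (row_matrix w N) = 0" for w
    by (simp add: det_row_matrix)
  note order = pull_conic_of[OF assms(1), folded N_def]
  obtain a where a: "\<exists>j<6. a j \<noteq> 0" "(\<Sum>j<6. 0 * a j) = 0" "\<forall>i<5. (\<Sum>j<6. N i j * a j) = 0"
    by (rule row_matrix_kernel[OF det[of "\<lambda>_. 0"]])
  obtain k where k: "k < 6" "a k \<noteq> 0" using a(1) by blast
  \<comment> \<open>A unit vector as first row forces \<open>b k = 0\<close>, which makes
    \<open>b\<close> independent of \<open>a\<close>.\<close>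
  obtain b where b: "\<exists>j<6. b j \<noteq> 0" "(\<Sum>j<6. (if j = k then 1 else 0) * b j) = 0"
      "\<forall>i<5. (\<Sum>j<6. N i j * b j) = 0"
    by (rule row_matrix_kernel[OF det[of "\<lambda>j. if j = k then 1 else 0"]])
  have "b k = 0" using b(2) k(1) by (simp add: if_distrib[of "\<lambda>x. x * _"] cong: if_cong)
  have "conic_of a \<noteq> 0" using conic_of_eq_0[of a k] k by blast
  then obtain c where "conic_of b = const3 c * conic_of a"
    using conics_proportional[OF T4 form3_conic_of order[OF b(3)[rule_format]] form3_conic_of order[OF a(3)[rule_format]]] by blast
  then have "conic_of (\<lambda>j. b j - c * a j) = 0"
    unfolding conic_of_diff[symmetric] by simp
  then have eq: "b j = c * a j" if "j < 6" for j
    using conic_of_eq_0[of "\<lambda>j. b j - c * a j"] that by fastforce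
  from eq[OF k(1)] \<open>b k = 0\<close> k(2) have "c = 0" by simp
  with eq b(1) show False by auto
qed

lemma omega_osculating:
  assumes "4 \<le> 2 * d" and mult_T: "intersection_mult p T F \<le> 3"
  shows "osculating_curve2 F p (omega \<phi> u)"
    and "meets_to_order5 F p Q \<Longrightarrow> same_curve Q (omega \<phi> u)"
proof -
  have T4: "\<not> fps_X ^ 4 dvd pull T"
    using order.trans[OF intersection_mult_ge[of 4 T] mult_T] by (auto simp: numeral_eq_enat)
  have form: "form3 2 (omega \<phi> u)"
    unfolding omega_conic_of by (rule form3_conic_of)
  have order: "fps_X ^ 5 dvd pull (omega \<phi> u)"
    unfolding omega_conic_of by (intro pull_conic_of assms minor_orthogonal)
  have nz: "omega \<phi> u \<noteq> 0" by (rule omega_nonzero[OF assms(1) T4])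
  have same: "same_curve Q (omega \<phi> u)" if Q: "form3 2 Q" "Q \<noteq> 0" "fps_X ^ 5 dvd pull Q" for Q
  proof -
    obtain c where "Q = const3 c * omega \<phi> u"
      using conics_proportional[OF T4 Q(1,3) form order nz] by blast
    with \<open>Q \<noteq> 0\<close> show ?thesis unfolding same_curve_def by (intro exI[of _ c]) auto
  qed
  show "same_curve Q (omega \<phi> u)" if "meets_to_order5 F p Q"
    using that same order_of_mult[of 2 Q 5]
    by (auto simp: meets_to_order5_def numeral_eq_enat)
  have meets: "meets_to_order5 F p (omega \<phi> u)"
    using form nz intersection_mult_ge[OF order] by (simp add: meets_to_order5_def numeral_eq_enat)
  moreover have "same_curve (omega \<phi> u) ((tangent_line F p)\<^sup>2)" if "inflection_point F p"
  proof -
    \<comment> \<open>At a flex the tangent line has contact order at least 3, so its square has at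
      least 6 and competes with \<open>omega\<close>.\<close>
    have "enat 3 \<le> intersection_mult p T F"
      using that ileI1[of 2 "intersection_mult p T F"]
      by (simp add: inflection_point_def T numeral_eq_enat eSuc_enat)
    then have "fps_X ^ 3 dvd pull T" by (rule order_of_mult[OF form_T])
    then have "fps_X ^ 3 * fps_X ^ 3 dvd pull T * pull T" by (intro mult_dvd_mono)
    moreover have "fps_X ^ 5 dvd fps_X ^ 3 * (fps_X ^ 3 :: complex fps)"
      unfolding power_add[symmetric] by (rule le_imp_power_dvd) simp
    ultimately have T5: "fps_X ^ 5 dvd pull (T\<^sup>2)"
      by (simp add: power2_eq_square pull.hom_mult dvd_trans)
    have "form3 2 (T\<^sup>2)" using form3_power[OF form_T, of 2] by simp
    moreover have "T\<^sup>2 \<noteq> 0" using T4 by auto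
    ultimately obtain c where "omega \<phi> u = const3 c * T\<^sup>2"
      using conics_proportional[OF T4 form order _ T5] by blast
    with nz show ?thesis
      unfolding same_curve_def T[symmetric] by (intro exI[of _ c]) auto
  qed
  ultimately show "osculating_curve2 F p (omega \<phi> u)"
    by (simp add: osculating_curve2_def)
qed

end

section \<open>Nonvanishing of \<open>p\<close> and choice of coordinates\<close>

lemma eval3_form_at_0:
  assumes "form3 (Suc n) A" "\<And>i. i < 3 \<Longrightarrow> p i = 0"
  shows "eval3 id A p = 0"
proof -
  interpret comm_ring_hom "\<lambda>A. eval3 id A p"
    by (intro comm_ring_hom_eval3 comm_ring_hom_id)
  obtain B where "A = (\<Sum>i<3. vars3 i * B i)" using form3_SucE[OF assms(1)] by blast
  then show ?thesis by (simp add: hom_sum hom_mult eval3_vars comm_ring_hom_id assms(2))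
qed

text \<open>Partial derivatives of a form of degree at least 2 have no constant term. A smooth point
  therefore has a nonzero coordinate vector.\<close>

lemma eval3_pd3_at_0:
  assumes "form3 (Suc (Suc n)) A" "\<And>i. i < 3 \<Longrightarrow> p i = 0" "j < 3"
  shows "eval3 id (pd3 j A) p = 0"
proof -
  interpret comm_ring_hom "\<lambda>A. eval3 id A p"
    by (intro comm_ring_hom_eval3 comm_ring_hom_id)
  obtain B where B: "\<And>i. i < 3 \<Longrightarrow> form3 (Suc n) (B i)" "A = (\<Sum>i<3. vars3 i * B i)"
    using form3_SucE[OF assms(1)] by blast
  have "eval3 id (B j) p = 0"
    using eval3_form_at_0[OF B(1)[OF assms(3)] assms(2)] .
  then show ?thesis
    unfolding B(2) pd3_lincomb[OF assms(3)]
    by (simp add: hom_add hom_sum hom_mult eval3_vars comm_ring_hom_id assms(2))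
qed

theorem theorem4p2:
  fixes d :: nat
    and F :: tripoly
    and \<phi> :: "nat \<Rightarrow> bipoly"
    and u p :: "nat \<Rightarrow> complex"
  assumes "d \<ge> 3"
    and "irreducible F" and "form3 d F"
    and "rational_parametrization d \<phi> F"
    and "u 0 \<noteq> 0 \<or> u 1 \<noteq> 0"
    and "\<And>i. i < 3 \<Longrightarrow> p i = eval2 id (\<phi> i) u"
    and "smooth_point F p"
    and no_hyperflex: "intersection_mult p (tangent_line F p) F \<le> 3"
  shows "osculating_curve2 F p (omega \<phi> u)
    \<and> (\<forall>Q. meets_to_order5 F p Q \<longrightarrow> same_curve Q (omega \<phi> u))"
proof -
  note param = assms(4)[unfolded rational_parametrization_def birational_onto_def]
  obtain \<psi> :: "nat \<Rightarrow> tripoly" and e where \<psi>: "\<forall>i<2. form3 e (\<psi> i)" "\<exists>i<2. eval3 const2 (\<psi> i) \<phi> \<noteq> 0"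
    "eval3 const2 (\<psi> 0) \<phi> * vars2 1 = eval3 const2 (\<psi> 1) \<phi> * vars2 0"
    using param by blast
  \<comment> \<open>A unit vector independent of \<open>u\<close>: (0, 1) if \<open>u 0\<close> is
    nonzero, and (1, 0) otherwise.\<close>
  define v :: "nat \<Rightarrow> complex" where "v i = (if (i = 0) = (u 0 \<noteq> 0) then 0 else 1)" for i
  have uv: "u 0 * v 1 - u 1 * v 0 \<noteq> 0"
    using assms(5) by (auto simp: v_def)
  interpret parametrized_point d F \<phi> u v p
    using assms param uv by unfold_locales auto
  define t where "t i = eval3 id (pd3 i F) p" for i
  have t: "\<exists>i<3. t i \<noteq> 0" using assms(7) by (auto simp: smooth_point_def t_def)
  have tp: "(\<Sum>i<3. t i * p i) = 0"
    using euler_form3_at[OF assms(3), of p] assms(7) by (simp add: t_def smooth_point_def mult.commute)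
  have "\<exists>i<3. p i \<noteq> 0"
  proof (rule ccontr)
    assume p0: "\<not> ?thesis"
    have "form3 (Suc (Suc (d - 2))) F" using assms(1,3) by (simp add: Suc_diff_Suc numeral_2_eq_2)
    from eval3_pd3_at_0[OF this] have "t i = 0" if "i < 3" for i
      using p0 that by (auto simp: t_def)
    with t show False by blast
  qed
  then obtain c l a b where *: "eval3 id (lin3 c) p = 1" "eval3 id (lin3 l) p = 0"
    "\<forall>i<3. vars3 i = const3 (p i) * lin3 c + const3 (a i) * lin3 l + const3 (b i) * lin3 t"
    "(\<Sum>i<3. l i * a i) = 1" "(\<Sum>i<3. t i * a i) = 0"
    by (rule adapted_coordinates[OF _ t tp])
  have T: "lin3 t = tangent_line F p"
    by (simp only: lin3_def tangent_line_def t_def)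
  interpret birational_point d F \<phi> u v p c l a b "lin3 t" \<psi> e
    by unfold_locales
      (fact T *(1,2) *(3)[rule_format] *(4) *(5)[unfolded t_def] \<psi>(1)[rule_format] \<psi>(2,3))+
  show ?thesis
    using omega_osculating no_hyperflex assms(1) by (simp add: T)
qed

end
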